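(* There exist a model $M_0$ of $PV^{\mathbb{N}}$, an element $\iota\in M_0$, a set $\mathcal{M}$ of models of $AR^{\mathbb{N}}$, and a probability measure $\nu$ on a $\sigma$-algebra $\mathcal{B}$ of subsets of $\mathcal{M}$ such that: (1) every model in $\mathcal{M}$ is an extension of $M_0$; (2) for every first-order formula $\phi(x_1,\dots,x_k)$ in the language of $PV$ and all elements $a_1,\dots,a_k\in M_0$, the set $\{M\in\mathcal{M} : M\models\phi(a_1,\dots,a_k)\}$ belongs to $\mathcal{B}$; (3) for every first-order formula $\sigma(x)$ in the language of $PV$ that defines a pseudorandom sequence $s$ (i.e. $s(n)=1$ if $\mathbb{N}\models\sigma(n)$ and $s(n)=-1$ otherwise, and this $s$ is pseudorandom), we have $\nu(\{M\in\mathcal{M} : M\models\sigma(\iota)\})=\tfrac12$, i.e. the probability that $s(\iota)=1$ holds in a $\nu$-random model from $\mathcal{M}$ is $\tfrac12$.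
   Context: The language of $PV$ (Cook's theory) contains a function symbol for every polynomial time computable function on natural numbers (given by algorithms defined by recursion on notation), interpreted in $\mathbb{N}$ in the natural way. $PV^{\mathbb{N}}$ is the theory axiomatized by all universal sentences in the language of $PV$ that are true in $\mathbb{N}$; $AR^{\mathbb{N}}$ is the set of all sentences in the language of $PV$ true in $\mathbb{N}$. A model $N$ is an extension of a model $M$ if $M$ is a substructure of $N$. A sequence $s:\mathbb{N}\to\{\pm1\}$ is pseudorandom if (i) $s$ is computable in nondeterministic polynomial time, meaning that the set $\{n : s(n)=1\}$ belongs to $\mathbf{NP}\cap\mathbf{coNP}$ (with inputs $n$ written in binary), and (ii) for every polynomial time computable function $f:\mathbb{N}\to\{\pm1\}$, $\lim_{n\to\infty}\frac1n\sum_{i=0}^{n-1}f(i)s(i)=0$. *)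

theory Defs
  imports
    "HOL-Probability.Probability"
    "HOL-Library.Log_Nat"
    "HOL-Computational_Algebra.Polynomial"
begin

text \<open>
  The term \<open>floorlog 2 n\<close> is the number of binary digits of \<open>n\<close>, with value \<open>0\<close> for \<open>n = 0\<close>.
  The constructors are Cobham's: zero, the successors \<open>2x\<close> and \<open>2x + 1\<close>, the smash function,
  projections, composition, and limited recursion on notation
  \<open>f(0,y) = g(y)\<close>, \<open>f(2x,y) = h\<^sub>0(x,f(x,y),y)\<close> (for \<open>x > 0\<close>), \<open>f(2x+1,y) = h\<^sub>1(x,f(x,y),y)\<close>,
  where \<open>f(x,y) \<le> k(x,y)\<close>. Projection and composition carry their arity so that
  every symbol has exactly one arity.
\<close>

datatype pv_alg =
    Zero
  | Succ0
  | Succ1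
  | Smash
  | Proj nat nat
  | Comp nat pv_alg "pv_alg list"
  | LRec pv_alg pv_alg pv_alg pv_alg

fun rec_notation ::
  "(nat list \<Rightarrow> nat) \<Rightarrow> (nat list \<Rightarrow> nat) \<Rightarrow> (nat list \<Rightarrow> nat) \<Rightarrow> nat \<Rightarrow> nat list \<Rightarrow> nat" where
  "rec_notation g h0 h1 x ys =
    (if x = 0 then g ys
     else (if even x then h0 else h1) (x div 2 # rec_notation g h0 h1 (x div 2) ys # ys))"

declare rec_notation.simps [simp del]

primrec pv_eval :: "pv_alg \<Rightarrow> nat list \<Rightarrow> nat" where
  "pv_eval Zero xs = 0"
| "pv_eval Succ0 xs = 2 * hd xs"
| "pv_eval Succ1 xs = 2 * hd xs + 1"
| "pv_eval Smash xs = 2 ^ (floorlog 2 (xs ! 0) * floorlog 2 (xs ! 1))"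
| "pv_eval (Proj n i) xs = xs ! i"
| "pv_eval (Comp n f gs) xs = pv_eval f (map (\<lambda>g. pv_eval g xs) gs)"
| "pv_eval (LRec g h0 h1 k) xs =
     rec_notation (pv_eval g) (pv_eval h0) (pv_eval h1) (hd xs) (tl xs)"

text \<open>
  \<open>pv_symbol n e\<close>: \<open>e\<close> is an \<open>n\<close>-ary function symbol of the language of PV. The bound in a
  recursion is required to hold in the natural numbers; \<open>pv_eval\<close> itself does not consult it.
\<close>

inductive pv_symbol :: "nat \<Rightarrow> pv_alg \<Rightarrow> bool" where
  "pv_symbol 0 Zero"
| "pv_symbol 1 Succ0"
| "pv_symbol 1 Succ1"
| "pv_symbol 2 Smash"
| "i < n \<Longrightarrow> pv_symbol n (Proj n i)"
| "\<lbrakk>pv_symbol (length gs) f; \<And>g. g \<in> set gs \<Longrightarrow> pv_symbol n g\<rbrakk> \<Longrightarrow> pv_symbol n (Comp n f gs)"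
| "\<lbrakk>pv_symbol n g; pv_symbol (n + 2) h0; pv_symbol (n + 2) h1; pv_symbol (n + 1) k;
    \<And>x ys. length ys = n \<Longrightarrow> pv_eval (LRec g h0 h1 k) (x # ys) \<le> pv_eval k (x # ys)\<rbrakk>
   \<Longrightarrow> pv_symbol (n + 1) (LRec g h0 h1 k)"

datatype pv_term = Var nat | Fun pv_alg "pv_term list"

datatype pv_form =
    Eq pv_term pv_term
  | Neg pv_form
  | Conj pv_form pv_form
  | All nat pv_form

primrec term_in_PV :: "pv_term \<Rightarrow> bool" where
  "term_in_PV (Var x) \<longleftrightarrow> True"
| "term_in_PV (Fun e ts) \<longleftrightarrow> pv_symbol (length ts) e \<and> list_all id (map term_in_PV ts)"

primrec form_in_PV :: "pv_form \<Rightarrow> bool" where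
  "form_in_PV (Eq t u) \<longleftrightarrow> term_in_PV t \<and> term_in_PV u"
| "form_in_PV (Neg \<phi>) \<longleftrightarrow> form_in_PV \<phi>"
| "form_in_PV (Conj \<phi> \<psi>) \<longleftrightarrow> form_in_PV \<phi> \<and> form_in_PV \<psi>"
| "form_in_PV (All x \<phi>) \<longleftrightarrow> form_in_PV \<phi>"

primrec fv_term :: "pv_term \<Rightarrow> nat set" where
  "fv_term (Var x) = {x}"
| "fv_term (Fun e ts) = \<Union> (set (map fv_term ts))"

primrec fv :: "pv_form \<Rightarrow> nat set" where
  "fv (Eq t u) = fv_term t \<union> fv_term u"
| "fv (Neg \<phi>) = fv \<phi>"
| "fv (Conj \<phi> \<psi>) = fv \<phi> \<union> fv \<psi>"
| "fv (All x \<phi>) = fv \<phi> - {x}"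

definition sentence :: "pv_form \<Rightarrow> bool" where
  "sentence \<phi> \<longleftrightarrow> form_in_PV \<phi> \<and> fv \<phi> = {}"

primrec quantifier_free :: "pv_form \<Rightarrow> bool" where
  "quantifier_free (Eq t u) \<longleftrightarrow> True"
| "quantifier_free (Neg \<phi>) \<longleftrightarrow> quantifier_free \<phi>"
| "quantifier_free (Conj \<phi> \<psi>) \<longleftrightarrow> quantifier_free \<phi> \<and> quantifier_free \<psi>"
| "quantifier_free (All x \<phi>) \<longleftrightarrow> False"

inductive universal :: "pv_form \<Rightarrow> bool" where
  "quantifier_free \<phi> \<Longrightarrow> universal \<phi>"
| "universal \<phi> \<Longrightarrow> universal (All x \<phi>)"

record 'a pv_struct =
  univ :: "'a set"
  interp :: "pv_alg \<Rightarrow> 'a list \<Rightarrow> 'a"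

definition is_structure :: "'a pv_struct \<Rightarrow> bool" where
  "is_structure M \<longleftrightarrow> univ M \<noteq> {} \<and>
    (\<forall>n e xs. pv_symbol n e \<and> length xs = n \<and> set xs \<subseteq> univ M \<longrightarrow> interp M e xs \<in> univ M)"

primrec term_val :: "'a pv_struct \<Rightarrow> (nat \<Rightarrow> 'a) \<Rightarrow> pv_term \<Rightarrow> 'a" where
  "term_val M v (Var x) = v x"
| "term_val M v (Fun e ts) = interp M e (map (term_val M v) ts)"

primrec sat :: "'a pv_struct \<Rightarrow> (nat \<Rightarrow> 'a) \<Rightarrow> pv_form \<Rightarrow> bool" where
  "sat M v (Eq t u) \<longleftrightarrow> term_val M v t = term_val M v u"
| "sat M v (Neg \<phi>) \<longleftrightarrow> \<not> sat M v \<phi>"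
| "sat M v (Conj \<phi> \<psi>) \<longleftrightarrow> sat M v \<phi> \<and> sat M v \<psi>"
| "sat M v (All x \<phi>) \<longleftrightarrow> (\<forall>a \<in> univ M. sat M (v(x := a)) \<phi>)"

definition true_in :: "'a pv_struct \<Rightarrow> pv_form \<Rightarrow> bool" where
  "true_in M \<phi> \<longleftrightarrow> (\<forall>v. range v \<subseteq> univ M \<longrightarrow> sat M v \<phi>)"

definition is_model :: "'a pv_struct \<Rightarrow> pv_form set \<Rightarrow> bool" where
  "is_model M T \<longleftrightarrow> is_structure M \<and> (\<forall>\<phi> \<in> T. true_in M \<phi>)"

definition is_extension :: "'a pv_struct \<Rightarrow> 'a pv_struct \<Rightarrow> bool" where
  "is_extension N M \<longleftrightarrow> is_structure M \<and> is_structure N \<and> univ M \<subseteq> univ N \<and>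
    (\<forall>n e xs. pv_symbol n e \<and> length xs = n \<and> set xs \<subseteq> univ M \<longrightarrow> interp N e xs = interp M e xs)"

definition std_model :: "nat pv_struct" where
  "std_model = \<lparr>univ = UNIV, interp = pv_eval\<rparr>"

definition PV_N :: "pv_form set" where
  "PV_N = {\<phi>. sentence \<phi> \<and> universal \<phi> \<and> true_in std_model \<phi>}"

definition AR_N :: "pv_form set" where
  "AR_N = {\<phi>. sentence \<phi> \<and> true_in std_model \<phi>}"

definition polytime :: "nat \<Rightarrow> (nat list \<Rightarrow> nat) \<Rightarrow> bool" where
  "polytime n f \<longleftrightarrow> (\<exists>e. pv_symbol n e \<and> (\<forall>xs. length xs = n \<longrightarrow> f xs = pv_eval e xs))"

text \<open>A \<open>\<plusminus>1\<close>-valued function is computed with the value \<open>-1\<close> coded by \<open>0\<close>.\<close>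

definition polytime_sign :: "(nat \<Rightarrow> real) \<Rightarrow> bool" where
  "polytime_sign f \<longleftrightarrow> range f \<subseteq> {1, -1} \<and> polytime 1 (\<lambda>xs. if f (hd xs) = 1 then 1 else 0)"

definition NP :: "nat set set" where
  "NP = {A. \<exists>R (p :: nat poly). polytime 2 R \<and>
    (\<forall>n. n \<in> A \<longleftrightarrow> (\<exists>w. floorlog 2 w \<le> poly p (floorlog 2 n) \<and> R [n, w] = 1))}"

definition coNP :: "nat set set" where
  "coNP = {A. - A \<in> NP}"

definition pseudorandom :: "(nat \<Rightarrow> real) \<Rightarrow> bool" where
  "pseudorandom s \<longleftrightarrow> range s \<subseteq> {1, -1} \<and> {n. s n = 1} \<in> NP \<inter> coNP \<and>
    (\<forall>f. polytime_sign f \<longrightarrow> (\<lambda>n. 1 / real n * (\<Sum>i<n. f i * s i)) \<longlonglongrightarrow> 0)"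

text \<open>
  For a formula with at most one free variable, the constant valuation \<open>\<lambda>_. a\<close> assigns \<open>a\<close>
  to that variable, whichever it is.
\<close>

definition sat1 :: "'a pv_struct \<Rightarrow> pv_form \<Rightarrow> 'a \<Rightarrow> bool" where
  "sat1 M \<sigma> a \<longleftrightarrow> sat M (\<lambda>_. a) \<sigma>"

definition defined_seq :: "pv_form \<Rightarrow> nat \<Rightarrow> real" where
  "defined_seq \<sigma> n = (if sat1 std_model \<sigma> n then 1 else -1)"

end

theory Submission
  imports Defs
begin

text \<open>
  Let \<open>d\<close> be the asymptotic density along a free ultrafilter. If \<open>s\<close> is pseudorandom and
  \<open>A\<close> is a polynomial time set, then \<open>d({s = 1} \<inter> A) = d(A)/2\<close>, since the indicator of \<open>A\<close>
  is a combination of two polynomial time \<open>\<plusminus>1\<close>-valued functions. Fix an ultrafilter all of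
  whose members have positive density, let \<open>F\<close> be the filter generated by the polynomial time
  sets in it, and let \<open>m\<close> be a limit of the conditional densities \<open>d(\<cdot> | A)\<close> as \<open>A\<close> shrinks
  along \<open>F\<close>. Then \<open>m\<close> is concentrated on \<open>F\<close> and \<open>m({s = 1}) = 1/2\<close>. By compactness and
  Caratheodory's theorem \<open>m\<close> extends to a measure on the Stone space of the ultrafilters \<open>U\<close>
  containing \<open>F\<close>. Each such \<open>U\<close> yields a model of true arithmetic, namely the ultrapower
  restricted to a countable Skolem closed family of functions. As \<open>F\<close> decides every equation
  between polynomial time functions, these functions modulo \<open>F\<close> form a common substructure
  \<open>M\<^sub>0\<close>, and \<open>\<iota>\<close> is the class of the identity.
\<close>

section \<open>Ultrafilters\<close>

text \<open>In the order of filters the smaller filter has more members, so the ultrafilters are the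
  minimal proper filters.\<close>

definition ultra :: "'a filter \<Rightarrow> bool" where
  "ultra U \<longleftrightarrow> U \<noteq> bot \<and> (\<forall>P. eventually P U \<or> eventually (\<lambda>x. \<not> P x) U)"

lemma ultra_not_bot: "ultra U \<Longrightarrow> U \<noteq> bot"
  by (simp add: ultra_def)

lemma ultra_eventually_not_iff:
  assumes "ultra U"
  shows "eventually (\<lambda>x. \<not> P x) U \<longleftrightarrow> \<not> eventually P U"
proof
  assume "eventually (\<lambda>x. \<not> P x) U"
  moreover have "\<not> eventually (\<lambda>x. False) U"
    using ultra_not_bot[OF assms] by (simp add: trivial_limit_def)
  ultimately show "\<not> eventually P U"
    using eventually_elim2[of P U "\<lambda>x. \<not> P x" "\<lambda>x. False"] by blast
qed (use assms in \<open>auto simp: ultra_def\<close>)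

lemma ultra_eventually_disj_iff:
  assumes "ultra U"
  shows "eventually (\<lambda>x. P x \<or> Q x) U \<longleftrightarrow> eventually P U \<or> eventually Q U"
  using ultra_eventually_not_iff[OF assms, of "\<lambda>x. \<not> P x \<and> \<not> Q x"]
  by (simp add: eventually_conj_iff ultra_eventually_not_iff[OF assms])

text \<open>If a property eventual in \<open>F\<close> were not eventual in \<open>U\<close>, its
  negation would be, and the infimum of the two filters would contain falsity.\<close>

lemma ultra_le_if_inf_not_bot:
  assumes "ultra U" "inf F U \<noteq> bot"
  shows "U \<le> F"
proof (rule filter_leI)
  fix P assume P: "eventually P F"
  show "eventually P U"
  proof (rule ccontr)
    assume "\<not> eventually P U"
    then have "eventually (\<lambda>x. \<not> P x) U"
      using ultra_eventually_not_iff[OF assms(1)] by blast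
    with P have "eventually (\<lambda>x. False) (inf F U)"
      unfolding eventually_inf by blast
    with assms(2) show False by (simp add: trivial_limit_def)
  qed
qed

text \<open>A property eventual in the infimum of a downward directed family is already eventual in
  one member, so falsity cannot be.\<close>

lemma directed_INF_not_bot:
  fixes F :: "'i \<Rightarrow> 'a filter"
  assumes "B \<noteq> {}" "\<And>a b. a \<in> B \<Longrightarrow> b \<in> B \<Longrightarrow> \<exists>x\<in>B. F x \<le> inf (F a) (F b)"
    "\<And>a. a \<in> B \<Longrightarrow> F a \<noteq> bot"
  shows "(INF b\<in>B. F b) \<noteq> bot"
  using assms(3) unfolding trivial_limit_def by (subst eventually_INF_base[OF assms(1,2)]) auto

text \<open>Zorn's lemma for the reversed order on the proper filters below \<open>F\<close>; a
  nonempty chain is bounded by its infimum, which is proper because a chain is directed.\<close>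

lemma ultra_exists:
  assumes "F \<noteq> bot"
  obtains U where "ultra U" "U \<le> F"
proof -
  define S where "S = {G. G \<noteq> bot \<and> G \<le> F}"
  have "\<exists>U\<in>S. \<forall>G\<in>S. G \<le> U \<longrightarrow> G = U"
  proof (rule predicate_Zorn[where P = "\<lambda>G H. H \<le> G", simplified])
    show "partial_order_on S (relation_of (\<lambda>G H. H \<le> G) S)"
      by (rule partial_order_on_relation_ofI) auto
    fix C assume C: "C \<in> Chains (relation_of (\<lambda>G H. H \<le> G) S)"
    then have CS: "C \<subseteq> S" and tot: "\<And>G H. G \<in> C \<Longrightarrow> H \<in> C \<Longrightarrow> G \<le> H \<or> H \<le> G"
      by (auto simp: Chains_def relation_of_def)
    show "\<exists>u\<in>S. \<forall>G\<in>C. u \<le> G"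
    proof (cases "C = {}")
      case True
      with assms show ?thesis by (auto simp: S_def)
    next
      case False
      then have "(INF G\<in>C. G) \<noteq> bot"
      proof (rule directed_INF_not_bot)
        fix G H assume "G \<in> C" "H \<in> C"
        with tot[of G H] show "\<exists>x\<in>C. x \<le> inf G H" by auto
      qed (use CS S_def in auto)
      moreover have "Inf C \<le> F"
        using False CS by (auto simp: S_def intro: Inf_lower2)
      ultimately have "Inf C \<in> S" by (simp add: S_def)
      then show ?thesis by (auto intro: Inf_lower)
    qed
  qed
  then obtain U where U: "U \<noteq> bot" "U \<le> F" and
    min: "\<And>G. G \<noteq> bot \<Longrightarrow> G \<le> F \<Longrightarrow> G \<le> U \<Longrightarrow> G = U"
    by (auto simp: S_def)
  \<comment> \<open>Adjoining \<open>P\<close> to the minimal filter \<open>U\<close> either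
    destroys properness, so that the negation is eventual, or changes nothing.\<close>
  have "eventually P U \<or> eventually (\<lambda>x. \<not> P x) U" for P
  proof (cases "inf U (principal {x. P x}) = bot")
    case True
    then show ?thesis by (auto simp: trivial_limit_def eventually_inf_principal)
  next
    case False
    then have "inf U (principal {x. P x}) = U"
      by (intro min) (use U(2) in \<open>auto intro: le_infI1\<close>)
    then have "U \<le> principal {x. P x}" by (metis inf.cobounded2)
    then show ?thesis by (simp add: le_principal)
  qed
  with U that show ?thesis by (auto simp: ultra_def)
qed

text \<open>The image of \<open>U\<close> is an ultrafilter on a compact interval; it has a cluster
  point, and an ultrafilter converges to each of its cluster points.\<close>

lemma ultra_bounded_convergent:
  fixes f :: "'a \<Rightarrow> real"
  assumes "ultra U" "\<And>x. f x \<in> {a..b}"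
  obtains l where "(f \<longlongrightarrow> l) U"
proof -
  have ultra': "ultra (filtermap f U)"
    using assms(1) by (auto simp: ultra_def eventually_filtermap filtermap_bot_iff)
  have "eventually (\<lambda>y. y \<in> {a..b}) (filtermap f U)"
    using assms(2) by (simp add: eventually_filtermap)
  then obtain l where "inf (nhds l) (filtermap f U) \<noteq> bot"
    using compact_Icc[of a b] ultra_not_bot[OF ultra'] unfolding compact_filter by blast
  then have "filtermap f U \<le> nhds l"
    by (rule ultra_le_if_inf_not_bot[OF ultra'])
  then show ?thesis using that by (simp add: filterlim_def)
qed

section \<open>Finitely additive probabilities\<close>

text \<open>Only finite additivity is required, since it survives limits along an ultrafilter,
  whereas countable additivity need not.\<close>

definition charge :: "('a set \<Rightarrow> real) \<Rightarrow> bool" where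
  "charge m \<longleftrightarrow> m UNIV = 1 \<and> (\<forall>D. 0 \<le> m D) \<and> (\<forall>D E. D \<inter> E = {} \<longrightarrow> m (D \<union> E) = m D + m E)"

lemma charge_UNIV: "charge m \<Longrightarrow> m UNIV = 1"
  and charge_nonneg: "charge m \<Longrightarrow> 0 \<le> m D"
  and charge_Un: "charge m \<Longrightarrow> D \<inter> E = {} \<Longrightarrow> m (D \<union> E) = m D + m E"
  by (auto simp: charge_def)

lemma charge_split: "charge m \<Longrightarrow> m D = m (D \<inter> E) + m (D - E)"
  using charge_Un[of m "D \<inter> E" "D - E"] by (simp add: Int_Diff_Un Int_Diff_disjoint)

lemma charge_mono: "charge m \<Longrightarrow> D \<subseteq> E \<Longrightarrow> m D \<le> m E"
  using charge_split[of m E D] charge_nonneg[of m "E - D"] by (simp add: Int_absorb1)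

lemma charge_le_1: "charge m \<Longrightarrow> m D \<le> 1"
  using charge_mono[of m D UNIV] by (simp add: charge_UNIV)

lemma charge_Compl: "charge m \<Longrightarrow> m (- D) = 1 - m D"
  using charge_split[of m UNIV D] by (simp add: charge_UNIV Compl_eq_Diff_UNIV)

lemma charge_empty: "charge m \<Longrightarrow> m {} = 0"
  using charge_Compl[of m UNIV] by (simp add: charge_UNIV)

lemma charge_null_mono: "charge m \<Longrightarrow> m E = 0 \<Longrightarrow> D \<subseteq> E \<Longrightarrow> m D = 0"
  using charge_mono[of m D E] charge_nonneg[of m D] by simp

lemma charge_Int_full: "charge m \<Longrightarrow> m E = 1 \<Longrightarrow> m (D \<inter> E) = m D"
  using charge_split[of m D E] charge_null_mono[of m "- E" "D - E"] charge_Compl[of m E] by auto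

lemma charge_conditional:
  assumes "charge m" "m A > 0"
  shows "charge (\<lambda>D. m (D \<inter> A) / m A)"
  unfolding charge_def
proof (intro conjI allI impI)
  fix D E :: "'a set" assume "D \<inter> E = {}"
  then have "m ((D \<union> E) \<inter> A) = m (D \<inter> A) + m (E \<inter> A)"
    unfolding Int_Un_distrib2 by (intro charge_Un assms) auto
  then show "m ((D \<union> E) \<inter> A) / m A = m (D \<inter> A) / m A + m (E \<inter> A) / m A"
    by (simp add: add_divide_distrib)
qed (use assms in \<open>auto simp: charge_nonneg\<close>)

text \<open>Bounded values converge along an ultrafilter, and limits commute with finite sums. Total
  mass 1 is asked only eventually, because the relative frequency among the first \<open>n\<close>
  numbers has total mass 0 at \<open>n = 0\<close>.\<close>

lemma charge_ultralimit:
  fixes m :: "'i \<Rightarrow> 'a set \<Rightarrow> real"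
  assumes U: "ultra U" and bd: "\<And>i D. m i D \<in> {0..1}" and UN: "eventually (\<lambda>i. m i UNIV = 1) U"
    and add: "\<And>i D E. D \<inter> E = {} \<Longrightarrow> m i (D \<union> E) = m i D + m i E"
  obtains l where "charge l" "\<And>D. ((\<lambda>i. m i D) \<longlongrightarrow> l D) U"
proof -
  have "\<exists>l. ((\<lambda>i. m i D) \<longlongrightarrow> l) U" for D
    using ultra_bounded_convergent[OF U, of "\<lambda>i. m i D" 0 1] bd by metis
  then obtain l where l: "((\<lambda>i. m i D) \<longlongrightarrow> l D) U" for D by metis
  note unique = tendsto_unique[OF ultra_not_bot[OF U]]
  have "charge l"
    unfolding charge_def
  proof (intro conjI allI impI)
    show "l UNIV = 1"
      by (rule unique[OF l tendsto_eventually[OF UN]])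
    show "0 \<le> l D" for D
      by (rule tendsto_lowerbound[OF l _ ultra_not_bot[OF U]]) (use bd in auto)
    show "l (D \<union> E) = l D + l E" if "D \<inter> E = {}" for D E
      by (rule unique[OF l]) (simp add: add[OF that] tendsto_add l)
  qed
  then show ?thesis using that l by blast
qed

text \<open>The value is the limit of relative frequencies along an ultrafilter finer than
  \<open>sequentially\<close>; a difference of frequencies with ordinary limit 0 therefore vanishes
  in \<open>d\<close>.\<close>

lemma density_charge:
  obtains d :: "nat set \<Rightarrow> real" where "charge d"
    and "\<And>D E. (\<lambda>n. (real (card (D \<inter> {..<n})) - real (card (E \<inter> {..<n}))) / real n) \<longlonglongrightarrow> 0 \<Longrightarrow> d D = d E"
proof -
  obtain U :: "nat filter" where U: "ultra U" "U \<le> sequentially"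
    using ultra_exists[OF sequentially_bot] .
  obtain d where d: "charge d" "\<And>D. ((\<lambda>n. real (card (D \<inter> {..<n})) / real n) \<longlongrightarrow> d D) U"
  proof (rule charge_ultralimit[OF U(1)])
    fix n and D E :: "nat set"
    have "card (D \<inter> {..<n}) \<le> card {..<n}" by (intro card_mono) auto
    then show "real (card (D \<inter> {..<n})) / real n \<in> {0..1}"
      by (cases "n = 0") auto
    assume "D \<inter> E = {}"
    then have "card ((D \<union> E) \<inter> {..<n}) = card (D \<inter> {..<n}) + card (E \<inter> {..<n})"
      unfolding Int_Un_distrib2 by (intro card_Un_disjoint) auto
    then show "real (card ((D \<union> E) \<inter> {..<n})) / real n
        = real (card (D \<inter> {..<n})) / real n + real (card (E \<inter> {..<n})) / real n"
      by (simp add: add_divide_distrib)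
  next
    have "eventually (\<lambda>n. n > 0) sequentially" by (rule eventually_gt_at_top)
    then show "\<forall>\<^sub>F n in U. real (card (UNIV \<inter> {..<n})) / real n = 1"
      by (rule filter_leD[OF U(2), OF eventually_mono]) auto
  qed blast
  have "d D = d E"
    if "(\<lambda>n. (real (card (D \<inter> {..<n})) - real (card (E \<inter> {..<n}))) / real n) \<longlonglongrightarrow> 0" for D E
  proof -
    have "((\<lambda>n. (real (card (D \<inter> {..<n})) - real (card (E \<inter> {..<n}))) / real n) \<longlongrightarrow> d D - d E) U"
      unfolding diff_divide_distrib by (intro tendsto_diff d)
    then have "d D - d E = 0"
      using tendsto_mono[OF U(2) that] ultra_not_bot[OF U(1)] by (blast intro: tendsto_unique)
    then show ?thesis by simp
  qed
  with d(1) that show ?thesis by blast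
qed

text \<open>Conditioning \<open>d\<close> on ever smaller members of \<open>\<A>\<close> lying in
  \<open>U\<close> gives each such member mass 1 in the limit, while a set of constant relative
  density \<open>c\<close> keeps this value.\<close>

lemma charge_concentrate:
  fixes d :: "'a set \<Rightarrow> real"
  assumes d: "charge d" and UN: "UNIV \<in> \<A>"
    and Int: "\<And>A B. A \<in> \<A> \<Longrightarrow> B \<in> \<A> \<Longrightarrow> A \<inter> B \<in> \<A>"
  obtains U m where "ultra U" "charge m"
    "\<And>A. A \<in> \<A> \<Longrightarrow> eventually (\<lambda>x. x \<in> A) U \<Longrightarrow> m A = 1"
    "\<And>S c. (\<And>A. A \<in> \<A> \<Longrightarrow> d (S \<inter> A) = c * d A) \<Longrightarrow> m S = c"
proof -
  \<comment> \<open>\<open>G\<close> consists of the sets of full measure. An ultrafilter below it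
    contains no null set, so conditioning on its members is possible.\<close>
  define G where "G = Abs_filter (\<lambda>P. d {x. P x} = 1)"
  have ev_G: "eventually P G \<longleftrightarrow> d {x. P x} = 1" for P
    unfolding G_def
  proof (rule eventually_Abs_filter, rule is_filter.intro)
    show "d {x. True} = 1" using charge_UNIV[OF d] by simp
    show "d {x. P x \<and> Q x} = 1" if "d {x. P x} = 1" "d {x. Q x} = 1" for P Q
      using charge_Int_full[OF d that(2), of "{x. P x}"] that(1) by (simp add: Collect_conj_eq)
    show "d {x. Q x} = 1" if "\<forall>x. P x \<longrightarrow> Q x" "d {x. P x} = 1" for P Q
      using charge_mono[OF d, of "{x. P x}" "{x. Q x}"] charge_le_1[OF d, of "{x. Q x}"] that
      by (simp add: Collect_mono)
  qed
  have "G \<noteq> bot"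
    by (simp add: trivial_limit_def ev_G charge_empty[OF d])
  then obtain U where U: "ultra U" "U \<le> G" by (rule ultra_exists)
  define Q where "Q = {A \<in> \<A>. eventually (\<lambda>x. x \<in> A) U}"
  have Q_pos: "d A > 0" if "A \<in> Q" for A
  proof (rule ccontr)
    assume "\<not> d A > 0"
    then have "d (- A) = 1"
      using charge_nonneg[OF d, of A] by (simp add: charge_Compl[OF d])
    then have "eventually (\<lambda>x. x \<notin> A) U"
      by (intro filter_leD[OF U(2)]) (simp add: ev_G Compl_eq)
    with that ultra_eventually_not_iff[OF U(1)] show False by (auto simp: Q_def)
  qed
  have Q_UN: "UNIV \<in> Q" using UN by (simp add: Q_def)
  have Q_Int: "A \<inter> B \<in> Q" if "A \<in> Q" "B \<in> Q" for A B
    using that Int by (simp add: Q_def eventually_conj_iff)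
  \<comment> \<open>The final segments of \<open>Q\<close> under reverse inclusion generate a proper
    filter, so there is an ultrafilter \<open>W\<close> on sets along which a member of
    \<open>Q\<close> eventually lies below any given one.\<close>
  have "(INF B\<in>Q. principal {A \<in> Q. A \<subseteq> B}) \<noteq> bot"
  proof (rule directed_INF_not_bot)
    fix A B assume AB: "A \<in> Q" "B \<in> Q"
    show "\<exists>x\<in>Q. principal {A \<in> Q. A \<subseteq> x} \<le> inf (principal {x \<in> Q. x \<subseteq> A}) (principal {A \<in> Q. A \<subseteq> B})"
      by (rule bexI[OF _ Q_Int[OF AB]]) auto
  qed (use Q_UN in \<open>auto simp: principal_eq_bot_iff\<close>)
  then obtain W where W: "ultra W" "W \<le> (INF B\<in>Q. principal {A \<in> Q. A \<subseteq> B})"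
    by (rule ultra_exists)
  have ev_W: "eventually (\<lambda>A. A \<in> Q \<and> A \<subseteq> B) W" if "B \<in> Q" for B
    by (rule filter_leD[OF W(2)], rule eventually_INF1[OF that]) (simp add: eventually_principal)
  \<comment> \<open>Outside \<open>Q\<close>, which \<open>W\<close> ignores, \<open>d\<close>
    serves as a default that makes every \<open>c A\<close> a charge.\<close>
  define c where "c A D = (if A \<in> Q then d (D \<inter> A) / d A else d D)" for A D
  have c: "charge (c A)" for A
    using charge_conditional[OF d Q_pos] d by (cases "A \<in> Q") (simp_all add: c_def[abs_def])
  obtain m where m: "charge m" "\<And>D. ((\<lambda>A. c A D) \<longlongrightarrow> m D) W"
    by (rule charge_ultralimit[OF W(1), of c])
      (auto simp: charge_nonneg[OF c] charge_le_1[OF c] charge_UNIV[OF c] charge_Un[OF c])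
  have m_eq: "m D = r" if "B \<in> Q" "\<And>A. A \<in> Q \<Longrightarrow> A \<subseteq> B \<Longrightarrow> c A D = r" for B D r
  proof -
    have "eventually (\<lambda>A. c A D = r) W"
      using ev_W[OF that(1)] by (rule eventually_mono) (use that(2) in blast)
    from tendsto_eventually[OF this] show ?thesis
      using m(2) ultra_not_bot[OF W(1)] by (blast intro: tendsto_unique)
  qed
  show ?thesis
  proof (rule that[OF U(1) m(1)])
    fix B assume "B \<in> \<A>" "eventually (\<lambda>x. x \<in> B) U"
    then have "B \<in> Q" by (simp add: Q_def)
    then show "m B = 1"
    proof (rule m_eq)
      fix A assume "A \<in> Q" "A \<subseteq> B"
      then show "c A B = 1" using Q_pos[of A] by (simp add: c_def Int_absorb1)
    qed
  next
    fix S r assume S: "\<And>A. A \<in> \<A> \<Longrightarrow> d (S \<inter> A) = r * d A"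
    show "m S = r"
    proof (rule m_eq[OF Q_UN])
      fix A assume "A \<in> Q"
      then show "c A S = r" using Q_pos[of A] S[of A] by (simp add: c_def Q_def)
    qed
  qed
qed

section \<open>The Stone space of ultrafilters below a filter\<close>

text \<open>These are the basic clopen sets of the Stone space, relativized to the closed subspace
  of the ultrafilters finer than \<open>F\<close>.\<close>

definition stone :: "'a filter \<Rightarrow> 'a set \<Rightarrow> 'a filter set" where
  "stone F D = {U. ultra U \<and> U \<le> F \<and> eventually (\<lambda>x. x \<in> D) U}"

lemma stone_Int: "stone F (D \<inter> E) = stone F D \<inter> stone F E"
  by (auto simp: stone_def eventually_conj_iff)

lemma stone_Un: "stone F (D \<union> E) = stone F D \<union> stone F E"
  by (auto simp: stone_def ultra_eventually_disj_iff)

lemma stone_Diff: "stone F (D - E) = stone F D - stone F E"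
  by (auto simp: stone_def eventually_conj_iff ultra_eventually_not_iff)

lemma stone_empty: "stone F {} = {}"
  by (auto simp: stone_def ultra_def)

text \<open>Unless the complement of \<open>D\<close> is eventual in \<open>F\<close>, adjoining
  \<open>D\<close> to \<open>F\<close> gives a proper filter, which extends to an
  ultrafilter.\<close>

lemma stone_eq_empty_iff: "stone F D = {} \<longleftrightarrow> eventually (\<lambda>x. x \<notin> D) F"
proof
  assume *: "stone F D = {}"
  show "eventually (\<lambda>x. x \<notin> D) F"
  proof (rule ccontr)
    assume "\<not> eventually (\<lambda>x. x \<notin> D) F"
    then have "inf F (principal D) \<noteq> bot"
      by (auto simp: trivial_limit_def eventually_inf_principal)
    then obtain U where "ultra U" "U \<le> inf F (principal D)" by (rule ultra_exists)
    then have "U \<in> stone F D" by (simp add: stone_def le_principal)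
    with * show False by simp
  qed
next
  assume "eventually (\<lambda>x. x \<notin> D) F"
  then show "stone F D = {}"
    by (auto simp: stone_def ultra_eventually_not_iff dest: filter_leD)
qed

text \<open>The basic sets decrease but the sets \<open>D i\<close> need not, so these are replaced
  by their finite intersections \<open>E n\<close>. Adjoining the \<open>E n\<close> to
  \<open>F\<close> gives a descending family of proper filters, and an ultrafilter below their
  infimum is a common point.\<close>

lemma stone_compact:
  assumes dec: "decseq (\<lambda>i. stone F (D i))" and ne: "\<And>i. stone F (D i) \<noteq> {}"
  shows "(\<Inter>i. stone F (D i)) \<noteq> {}"
proof -
  define E where "E n = (\<Inter>i\<le>n. D i)" for n :: nat
  have stone_E: "stone F (E n) = stone F (D n)" for n
  proof (induction n)
    case (Suc n)
    then show ?case
      using decseqD[OF dec, of n "Suc n"] by (auto simp: E_def atMost_Suc stone_Int)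
  qed (simp add: E_def)
  have "(INF n. inf F (principal (E n))) \<noteq> bot"
  proof (rule directed_INF_not_bot)
    fix a b :: nat
    have "E (max a b) \<subseteq> E a" "E (max a b) \<subseteq> E b" by (force simp: E_def)+
    then have "inf F (principal (E (max a b))) \<le> inf (inf F (principal (E a))) (inf F (principal (E b)))"
      by (intro inf_greatest inf_mono) (auto intro: le_infI2)
    then show "\<exists>x\<in>UNIV. inf F (principal (E x)) \<le> inf (inf F (principal (E a))) (inf F (principal (E b)))"
      by blast
  next
    fix n
    show "inf F (principal (E n)) \<noteq> bot"
      using ne[of n] unfolding stone_E[symmetric] stone_eq_empty_iff
      by (simp add: trivial_limit_def eventually_inf_principal)
  qed simp
  then obtain U where U: "ultra U" "U \<le> (INF n. inf F (principal (E n)))" by (rule ultra_exists)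
  have "U \<in> stone F (E n)" for n
    using U(1) order_trans[OF U(2) INF_lower[of n UNIV]]
    by (simp add: stone_def le_principal)
  then show ?thesis unfolding stone_E by blast
qed

text \<open>By compactness a decreasing sequence of basic sets with empty intersection reaches the
  empty set, so continuity at the empty set is automatic and Caratheodory's theorem applies.\<close>

lemma stone_measure_exists:
  assumes m: "charge m" and full: "\<And>D. eventually (\<lambda>x. x \<in> D) F \<Longrightarrow> m D = 1"
  obtains \<mu> where "prob_space \<mu>" "space \<mu> = stone F UNIV"
    "\<And>D. stone F D \<in> sets \<mu>" "\<And>D. measure \<mu> (stone F D) = m D"
proof -
  define R where "R = range (stone F)"
  have null: "m D = 0" if "stone F D = {}" for D
    using full[of "- D"] that by (simp add: stone_eq_empty_iff charge_Compl[OF m])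
  \<comment> \<open>A basic set determines \<open>D\<close> only up to \<open>m\<close>-null
    differences, which suffices for its measure to be well defined.\<close>
  have eq: "m D = m E" if "stone F D = stone F E" for D E
  proof -
    have "m (D - E) = 0" "m (E - D) = 0" using that by (auto intro!: null simp: stone_Diff)
    then show ?thesis
      using charge_split[OF m, of D E] charge_split[OF m, of E D] by (simp add: Int_commute)
  qed
  define f where "f A = ennreal (m (SOME D. A = stone F D))" for A
  have f: "f (stone F D) = ennreal (m D)" for D
    unfolding f_def by (rule arg_cong[where f = ennreal], rule eq) (metis (mono_tags) someI)
  interpret ring_of_sets "stone F UNIV" R
    unfolding ring_of_sets_iff
  proof (intro conjI ballI)
    show "R \<subseteq> Pow (stone F UNIV)" by (auto simp: R_def stone_def)
    show "{} \<in> R" unfolding R_def stone_empty[of F, symmetric] by blast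
  qed (auto simp: R_def simp flip: stone_Un stone_Diff)
  have "\<exists>\<mu>. (\<forall>s\<in>R. \<mu> s = f s) \<and> measure_space (stone F UNIV) (sigma_sets (stone F UNIV) R) \<mu>"
  proof (rule caratheodory_empty_continuous)
    show "positive R f"
      using f[of "{}"] by (simp add: positive_def stone_empty charge_empty[OF m])
    show "additive R f"
      unfolding additive_def R_def
    proof safe
      fix D E assume "stone F D \<inter> stone F E = {}"
      then have "m (D \<inter> E) = 0" by (intro null) (simp add: stone_Int)
      then have "m (D \<union> E) = m D + m E"
        using charge_split[OF m, of D E] charge_Un[OF m, of "D - E" E]
        by (simp add: Int_commute)
      then show "f (stone F D \<union> stone F E) = f (stone F D) + f (stone F E)"
        by (simp add: f charge_nonneg[OF m] flip: stone_Un)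
    qed
    show "f A \<noteq> \<infinity>" for A by (simp add: f_def)
    fix A :: "nat \<Rightarrow> 'a filter set"
    assume A: "range A \<subseteq> R" "decseq A" "(\<Inter>i. A i) = {}"
    then have "\<forall>i. \<exists>D. A i = stone F D" unfolding R_def by blast
    then obtain D where D: "\<And>i. A i = stone F (D i)" by metis
    then have "A = (\<lambda>i. stone F (D i))" by auto
    with A stone_compact[of F D] obtain k where "A k = {}" by auto
    have "f (A i) = 0" if "i \<ge> k" for i
    proof -
      have "A i = {}" using decseqD[OF A(2) that] \<open>A k = {}\<close> by simp
      then show ?thesis using D[of i] f[of "D i"] null[of "D i"] by simp
    qed
    then show "(\<lambda>i. f (A i)) \<longlonglongrightarrow> 0"
      by (intro tendsto_eventually) (auto simp: eventually_sequentially)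
  qed
  then obtain \<mu> where \<mu>: "\<And>s. s \<in> R \<Longrightarrow> \<mu> s = f s"
    "measure_space (stone F UNIV) (sigma_sets (stone F UNIV) R) \<mu>" by blast
  define M where "M = measure_of (stone F UNIV) R \<mu>"
  have sets: "stone F D \<in> sets M" for D
    using space_closed by (simp add: M_def R_def sigma_sets.Basic)
  have sets_M: "sets M = sigma_sets (stone F UNIV) R"
    using space_closed by (simp add: M_def)
  have em: "emeasure M (stone F D) = ennreal (m D)" for D
    using \<mu> sets[of D] space_closed
    by (subst emeasure_measure_of[OF M_def])
      (auto simp: R_def f measure_space_def sets_M)
  have sp: "space M = stone F UNIV"
    using space_closed by (simp add: M_def space_measure_of)
  show ?thesis
  proof (rule that[of M])
    show "prob_space M"
      by (rule prob_spaceI) (simp add: sp em charge_UNIV[OF m])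
    show "measure M (stone F D) = m D" for D
      by (simp add: measure_def em charge_nonneg[OF m])
  qed (use sp sets in auto)
qed

section \<open>Polynomial time functions and sets\<close>

lemma polytime_cong:
  assumes "polytime n f" "\<And>xs. length xs = n \<Longrightarrow> f xs = g xs"
  shows "polytime n g"
  using assms unfolding polytime_def by metis

lemma polytime_Proj: "i < n \<Longrightarrow> polytime n (\<lambda>xs. xs ! i)"
  unfolding polytime_def by (rule exI[of _ "Proj n i"]) (simp add: pv_symbol.intros)

lemma polytime_Comp:
  assumes "polytime (length gs) f" "\<And>g. g \<in> set gs \<Longrightarrow> polytime n g"
  shows "polytime n (\<lambda>xs. f (map (\<lambda>g. g xs) gs))"
proof -
  obtain e where e: "pv_symbol (length gs) e" "\<And>xs. length xs = length gs \<Longrightarrow> f xs = pv_eval e xs"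
    using assms(1) by (auto simp: polytime_def)
  have "\<forall>g\<in>set gs. \<exists>d. pv_symbol n d \<and> (\<forall>xs. length xs = n \<longrightarrow> g xs = pv_eval d xs)"
    using assms(2) by (simp add: polytime_def)
  then obtain d where d: "\<And>g. g \<in> set gs \<Longrightarrow> pv_symbol n (d g)"
    "\<And>g xs. g \<in> set gs \<Longrightarrow> length xs = n \<Longrightarrow> g xs = pv_eval (d g) xs" by metis
  have "f (map (\<lambda>g. g xs) gs) = pv_eval (Comp n e (map d gs)) xs" if "length xs = n" for xs
    using d(2)[OF _ that] e(2)[of "map (\<lambda>g. g xs) gs"] by (simp add: comp_def cong: map_cong)
  moreover have "pv_symbol n (Comp n e (map d gs))"
    using e(1) d(1) by (intro pv_symbol.intros) auto
  ultimately show ?thesis unfolding polytime_def by blast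
qed

lemma polytime_Comp1:
  "polytime 1 (\<lambda>xs. f (xs ! 0)) \<Longrightarrow> polytime n g \<Longrightarrow> polytime n (\<lambda>xs. f (g xs))"
  using polytime_Comp[of "[g]" "\<lambda>xs. f (xs ! 0)" n] by simp

lemma polytime_Comp2:
  "polytime 2 (\<lambda>xs. f (xs ! 0) (xs ! 1)) \<Longrightarrow> polytime n g \<Longrightarrow> polytime n h \<Longrightarrow>
    polytime n (\<lambda>xs. f (g xs) (h xs))"
  using polytime_Comp[of "[g, h]" "\<lambda>xs. f (xs ! 0) (xs ! 1)" n]
  by (auto simp: numeral_2_eq_2)

lemma polytime_Comp3:
  "polytime 3 (\<lambda>xs. f (xs ! 0) (xs ! 1) (xs ! 2)) \<Longrightarrow> polytime n g \<Longrightarrow> polytime n h \<Longrightarrow>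
    polytime n k \<Longrightarrow> polytime n (\<lambda>xs. f (g xs) (h xs) (k xs))"
  using polytime_Comp[of "[g, h, k]" "\<lambda>xs. f (xs ! 0) (xs ! 1) (xs ! 2)" n]
  by (auto simp: eval_nat_numeral)

lemma polytime_0: "polytime n (\<lambda>xs. 0)"
  unfolding polytime_def
  by (rule exI[of _ "Comp n Zero []"]) (auto intro!: pv_symbol.intros)

lemma polytime_1: "polytime n (\<lambda>xs. 1)"
proof -
  have "polytime 1 (\<lambda>xs. 2 * (xs ! 0) + 1)"
    unfolding polytime_def
    by (rule exI[of _ Succ1]) (use pv_symbol.intros(3) in \<open>auto simp: length_Suc_conv\<close>)
  from polytime_Comp1[OF this polytime_0] show ?thesis by simp
qed

text \<open>The semantic form of limited recursion. The step equation is stated for positive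
  \<open>x\<close>, so that the even case does not clash with the base case at 0. Arities enter
  through equations so that numerals can be supplied for them.\<close>

lemma polytime_LRec:
  assumes N: "N = n + 1" "N' = n + 2"
    and gh: "polytime n g" "polytime N' h0" "polytime N' h1" "polytime N k"
    and f0: "\<And>ys. length ys = n \<Longrightarrow> f (0 # ys) = g ys"
    and f: "\<And>x ys. length ys = n \<Longrightarrow> x > 0 \<Longrightarrow>
      f (x # ys) = (if even x then h0 else h1) (x div 2 # f (x div 2 # ys) # ys)"
    and bound: "\<And>x ys. length ys = n \<Longrightarrow> f (x # ys) \<le> k (x # ys)"
  shows "polytime N f"
proof -
  obtain eg e0 e1 ek where
    g: "pv_symbol n eg" "\<And>xs. length xs = n \<Longrightarrow> g xs = pv_eval eg xs" and
    h0: "pv_symbol (n + 2) e0" "\<And>xs. length xs = n + 2 \<Longrightarrow> h0 xs = pv_eval e0 xs" and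
    h1: "pv_symbol (n + 2) e1" "\<And>xs. length xs = n + 2 \<Longrightarrow> h1 xs = pv_eval e1 xs" and
    k: "pv_symbol (n + 1) ek" "\<And>xs. length xs = n + 1 \<Longrightarrow> k xs = pv_eval ek xs"
    using gh unfolding polytime_def N by metis
  have eq: "f (x # ys) = pv_eval (LRec eg e0 e1 ek) (x # ys)" if "length ys = n" for x ys
  proof (induction x rule: less_induct)
    case (less x)
    then show ?case
      using that f0[of ys] f[of ys x] g(2)[of ys] h0(2)[of "x div 2 # f (x div 2 # ys) # ys"]
        h1(2)[of "x div 2 # f (x div 2 # ys) # ys"]
      by (cases "x = 0") (simp_all add: rec_notation.simps[of _ _ _ x] rec_notation.simps[of _ _ _ 0])
  qed
  have "pv_symbol (n + 1) (LRec eg e0 e1 ek)"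
  proof (rule pv_symbol.intros(7)[OF g(1) h0(1) h1(1) k(1)])
    fix x ys assume "length (ys :: nat list) = n"
    then show "pv_eval (LRec eg e0 e1 ek) (x # ys) \<le> pv_eval ek (x # ys)"
      using bound[of ys x] eq[of ys x] k(2)[of "x # ys"] by simp
  qed
  moreover have "f xs = pv_eval (LRec eg e0 e1 ek) xs" if "length xs = n + 1" for xs
    using eq[of "tl xs" "hd xs"] that by (cases xs) auto
  ultimately show ?thesis unfolding polytime_def N by blast
qed

section \<open>Operations on binary digits\<close>

lemma polytime_div2: "polytime 1 (\<lambda>xs. xs ! 0 div 2)"
  by (rule polytime_LRec[of 1 0 2 "\<lambda>_. 0" "\<lambda>xs. xs ! 0" "\<lambda>xs. xs ! 0" "\<lambda>xs. xs ! 0"])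
    (auto intro: polytime_0 polytime_Proj)

lemma polytime_mod2: "polytime 1 (\<lambda>xs. xs ! 0 mod 2)"
  by (rule polytime_LRec[of 1 0 2 "\<lambda>_. 0" "\<lambda>_. 0" "\<lambda>_. 1" "\<lambda>_. 1"])
    (simp_all add: polytime_0 polytime_1 mod2_eq_if del: One_nat_def)

text \<open>Recursion on the first argument, each of whose digits removes the last digit of the
  value obtained so far; the value stays below the second argument.\<close>

lemma polytime_shift: "polytime 2 (\<lambda>xs. xs ! 1 div 2 ^ floorlog 2 (xs ! 0))"
proof -
  have h: "polytime 3 (\<lambda>xs. xs ! 1 div 2)"
    by (rule polytime_Comp1[OF polytime_div2]) (simp add: polytime_Proj)
  have fl0: "floorlog 2 0 = 0" by (simp add: floorlog_def)
  have fl: "z div 2 ^ floorlog 2 x = z div 2 ^ floorlog 2 (x div 2) div 2" if "x > 0" for x z :: nat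
    using that compute_floorlog[of 2 x] by (simp add: div_mult2_eq mult.commute flip: div_mult2_eq)
  show ?thesis
    by (rule polytime_LRec[of 2 1 3 "\<lambda>xs. xs ! 0" "\<lambda>xs. xs ! 1 div 2" "\<lambda>xs. xs ! 1 div 2" "\<lambda>xs. xs ! 1"])
      (auto intro: polytime_Proj h[simplified] simp: fl fl0)
qed

section \<open>Polynomial time predicates and the equality test\<close>

definition polytime_pred :: "nat \<Rightarrow> (nat list \<Rightarrow> bool) \<Rightarrow> bool" where
  "polytime_pred n Q \<longleftrightarrow> polytime n (\<lambda>xs. if Q xs then 1 else 0)"

text \<open>The recursion serves as a case distinction between zero and positive numbers, with the
  earlier value ignored.\<close>

lemma polytime_pred_not:
  assumes "polytime_pred n Q"
  shows "polytime_pred n (\<lambda>xs. \<not> Q xs)"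
proof -
  have "polytime 1 (\<lambda>xs. if xs ! 0 = 0 then 1 else 0)"
    by (rule polytime_LRec[of 1 0 2 "\<lambda>_. 1" "\<lambda>_. 0" "\<lambda>_. 0" "\<lambda>_. 1"])
      (simp_all add: polytime_0 polytime_1 del: One_nat_def)
  from polytime_Comp1[OF this assms[unfolded polytime_pred_def]] show ?thesis
    unfolding polytime_pred_def by (rule polytime_cong) auto
qed

lemma polytime_pred_conj:
  assumes "polytime_pred n Q" "polytime_pred n R"
  shows "polytime_pred n (\<lambda>xs. Q xs \<and> R xs)"
proof -
  have "polytime 2 (\<lambda>xs. if xs ! 0 = 0 then 0 else xs ! 1)"
    by (rule polytime_LRec[of 2 1 3 "\<lambda>_. 0" "\<lambda>xs. xs ! 2" "\<lambda>xs. xs ! 2" "\<lambda>xs. xs ! 1"])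
      (auto intro: polytime_0 polytime_Proj)
  from polytime_Comp2[OF this assms[unfolded polytime_pred_def]] show ?thesis
    unfolding polytime_pred_def by (rule polytime_cong) auto
qed

lemma polytime_pred_odd:
  assumes "polytime n f"
  shows "polytime_pred n (\<lambda>xs. odd (f xs))"
  using polytime_Comp1[OF polytime_mod2 assms]
  unfolding polytime_pred_def by (rule polytime_cong) (simp add: mod2_eq_if)

lemma polytime_pred_iff:
  assumes "polytime_pred n Q" "polytime_pred n R"
  shows "polytime_pred n (\<lambda>xs. Q xs \<longleftrightarrow> R xs)"
proof -
  have "polytime_pred n (\<lambda>xs. \<not> (Q xs \<and> \<not> R xs) \<and> \<not> (\<not> Q xs \<and> R xs))"
    by (intro polytime_pred_conj polytime_pred_not assms)
  moreover have "(\<lambda>xs. \<not> (Q xs \<and> \<not> R xs) \<and> \<not> (\<not> Q xs \<and> R xs)) = (\<lambda>xs. Q xs \<longleftrightarrow> R xs)"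
    by auto
  ultimately show ?thesis by simp
qed

text \<open>Digit \<open>k\<close> is the parity of the quotient by \<open>2 ^ k\<close>, and it is
  the only new digit when passing from \<open>k\<close> to \<open>k + 1\<close> digits.\<close>

lemma mod_pow2_Suc_eq_iff:
  fixes x y :: nat
  shows "x mod 2 ^ Suc k = y mod 2 ^ Suc k \<longleftrightarrow>
    x mod 2 ^ k = y mod 2 ^ k \<and> (odd (x div 2 ^ k) \<longleftrightarrow> odd (y div 2 ^ k))"
proof -
  have split: "z mod 2 ^ Suc k = 2 ^ k * (z div 2 ^ k mod 2) + z mod 2 ^ k" for z :: nat
    using mod_mult2_eq[of z "2 ^ k" 2] by (simp add: mult.commute)
  have "(z mod 2 ^ Suc k) mod 2 ^ k = z mod 2 ^ k" for z :: nat
    by (simp only: split mod_mult_self4 mod_mod_trivial)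
  then have "x mod 2 ^ Suc k = y mod 2 ^ Suc k \<longleftrightarrow>
      x mod 2 ^ k = y mod 2 ^ k \<and> x mod 2 ^ Suc k = y mod 2 ^ Suc k" by metis
  also have "\<dots> \<longleftrightarrow> x mod 2 ^ k = y mod 2 ^ k \<and> x div 2 ^ k mod 2 = y div 2 ^ k mod 2"
    unfolding split by auto
  finally show ?thesis by (auto simp: mod2_eq_if split: if_splits)
qed

text \<open>Digitwise comparison by recursion on the first argument, whose length counts the digits
  compared.\<close>

lemma polytime_pred_cong_pow2:
  "polytime_pred 3 (\<lambda>xs. xs ! 1 mod 2 ^ floorlog 2 (xs ! 0) = xs ! 2 mod 2 ^ floorlog 2 (xs ! 0))"
proof -
  \<comment> \<open>The arguments of \<open>h\<close> are the halved counter, the verdict so far and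
    the two numbers; shifting by the length of the halved counter exposes the next digit.\<close>
  define h where "h = (\<lambda>xs :: nat list. if odd (xs ! 1) \<and>
    (odd (xs ! 2 div 2 ^ floorlog 2 (xs ! 0)) \<longleftrightarrow> odd (xs ! 3 div 2 ^ floorlog 2 (xs ! 0)))
    then 1 else 0 :: nat)"
  have h: "polytime 4 h"
    unfolding h_def
    by (rule polytime_pred_conj[unfolded polytime_pred_def, OF polytime_pred_odd[unfolded polytime_pred_def]
          polytime_pred_iff[unfolded polytime_pred_def, OF polytime_pred_odd[unfolded polytime_pred_def]
          polytime_pred_odd[unfolded polytime_pred_def]]])
      (auto intro!: polytime_Proj polytime_Comp2[OF polytime_shift])
  have fl: "floorlog 2 x = Suc (floorlog 2 (x div 2))" if "x > 0" for x
    using that by (subst compute_floorlog) simp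
  show ?thesis
    unfolding polytime_pred_def
  proof (rule polytime_LRec[of 3 2 4 "\<lambda>_. 1" h h "\<lambda>_. 1"])
    fix x :: nat and ys :: "nat list" assume "length ys = 2" "x > 0"
    let ?F = "\<lambda>xs :: nat list. if xs ! 1 mod 2 ^ floorlog 2 (xs ! 0) = xs ! 2 mod 2 ^ floorlog 2 (xs ! 0)
      then 1 else 0 :: nat"
    show "?F (x # ys) = (if even x then h else h) (x div 2 # ?F (x div 2 # ys) # ys)"
      using mod_pow2_Suc_eq_iff[of "ys ! 0" "floorlog 2 (x div 2)" "ys ! 1"]
      by (simp add: h_def fl[OF \<open>x > 0\<close>] nth_Cons' del: power_Suc)
  qed (use h in \<open>simp_all add: polytime_1 floorlog_def del: One_nat_def\<close>)
qed

text \<open>Both numbers are smaller than the power of 2 given by the length of the larger one, so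
  agreement modulo the powers for both lengths is equality.\<close>

lemma polytime_pred_eq:
  assumes "polytime n f" "polytime n g"
  shows "polytime_pred n (\<lambda>xs. f xs = g xs)"
proof -
  let ?E = "\<lambda>z x y :: nat. x mod 2 ^ floorlog 2 z = y mod 2 ^ floorlog 2 z"
  have "polytime_pred n (\<lambda>xs. ?E (f xs) (f xs) (g xs) \<and> ?E (g xs) (f xs) (g xs))"
    unfolding polytime_pred_def
    by (rule polytime_pred_conj[unfolded polytime_pred_def];
        rule polytime_Comp3[OF polytime_pred_cong_pow2[unfolded polytime_pred_def]]) (fact assms)+
  moreover have "?E x x y \<and> ?E y x y \<longleftrightarrow> x = y" for x y
  proof
    assume E: "?E x x y \<and> ?E y x y"
    have lt: "x < 2 ^ floorlog 2 x" "y < 2 ^ floorlog 2 y" by (simp_all add: floorlog_leD)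
    show "x = y"
    proof (cases "x \<le> y")
      case True
      then have "x < 2 ^ floorlog 2 y" using lt(2) by simp
      with E lt show ?thesis by simp
    next
      case False
      then have "y < 2 ^ floorlog 2 x" using lt(1) by simp
      with E lt show ?thesis by simp
    qed
  qed simp
  ultimately show ?thesis by simp
qed

section \<open>Unary functions and sets of polynomial time\<close>

definition polytime_sets :: "nat set set" where
  "polytime_sets = {A. polytime_pred 1 (\<lambda>xs. hd xs \<in> A)}"

definition polytime_funs :: "(nat \<Rightarrow> nat) set" where
  "polytime_funs = {f. polytime 1 (\<lambda>xs. f (hd xs))}"

lemma polytime_sets_UNIV: "UNIV \<in> polytime_sets"
  using polytime_1 by (simp add: polytime_sets_def polytime_pred_def)

lemma polytime_sets_Compl: "A \<in> polytime_sets \<Longrightarrow> - A \<in> polytime_sets"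
  using polytime_pred_not by (fastforce simp: polytime_sets_def)

lemma polytime_sets_Int: "A \<in> polytime_sets \<Longrightarrow> B \<in> polytime_sets \<Longrightarrow> A \<inter> B \<in> polytime_sets"
  using polytime_pred_conj by (fastforce simp: polytime_sets_def)

lemma polytime_sets_eq:
  "f \<in> polytime_funs \<Longrightarrow> g \<in> polytime_funs \<Longrightarrow> {n. f n = g n} \<in> polytime_sets"
  using polytime_pred_eq by (fastforce simp: polytime_sets_def polytime_funs_def)

lemma polytime_funs_id: "(\<lambda>n. n) \<in> polytime_funs"
proof -
  have "polytime 1 (\<lambda>xs. xs ! 0)" by (simp add: polytime_Proj)
  then have "polytime 1 hd" by (rule polytime_cong) (auto simp: length_Suc_conv)
  then show ?thesis by (simp add: polytime_funs_def)
qed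

lemma polytime_funs_Comp:
  assumes "pv_symbol (length gs) e" "set gs \<subseteq> polytime_funs"
  shows "(\<lambda>n. pv_eval e (map (\<lambda>g. g n) gs)) \<in> polytime_funs"
proof -
  have "polytime (length (map (\<lambda>g xs. g (hd xs)) gs)) (pv_eval e)"
    using assms(1) by (auto simp: polytime_def)
  then have "polytime 1 (\<lambda>xs. pv_eval e (map (\<lambda>g. g xs) (map (\<lambda>g xs. g (hd xs)) gs)))"
    by (rule polytime_Comp) (use assms(2) in \<open>auto simp: polytime_funs_def\<close>)
  then show ?thesis by (simp add: polytime_funs_def comp_def)
qed

lemma polytime_funs_pv_eval:
  assumes "f \<in> polytime_funs"
  obtains e where "f = (\<lambda>n. pv_eval e [n])"
proof -
  from assms obtain e where "\<And>xs. length xs = 1 \<Longrightarrow> f (hd xs) = pv_eval e xs"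
    by (auto simp: polytime_funs_def polytime_def)
  from this[of "[_]"] that show ?thesis by auto
qed

lemma polytime_sign_set:
  assumes "A \<in> polytime_sets"
  shows "polytime_sign (\<lambda>n. if n \<in> A then 1 else -1)"
  using assms
  unfolding polytime_sign_def polytime_sets_def polytime_pred_def
  by (auto elim!: polytime_cong)

section \<open>Basic model theory\<close>

lemma term_val_cong:
  "(\<And>i. i \<in> fv_term t \<Longrightarrow> v i = w i) \<Longrightarrow> term_val M v t = term_val M w t"
proof (induction t)
  case (Fun e ts)
  then have "map (term_val M v) ts = map (term_val M w) ts" by auto
  then show ?case by (simp only: term_val.simps)
qed simp

lemma sat_cong: "(\<And>i. i \<in> fv \<phi> \<Longrightarrow> v i = w i) \<Longrightarrow> sat M v \<phi> \<longleftrightarrow> sat M w \<phi>"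
proof (induction \<phi> arbitrary: v w)
  case (Eq t u)
  then show ?case using term_val_cong[of t v w M] term_val_cong[of u v w M] by simp
next
  case (All x \<phi>)
  have "sat M (v(x := a)) \<phi> \<longleftrightarrow> sat M (w(x := a)) \<phi>" for a
    by (rule All.IH) (use All.prems in auto)
  then show ?case by simp
next
  case (Neg \<phi>)
  have "sat M v \<phi> \<longleftrightarrow> sat M w \<phi>"
    by (rule Neg.IH) (use Neg.prems in auto)
  then show ?case by simp
next
  case (Conj \<phi> \<psi>)
  have "sat M v \<phi> \<longleftrightarrow> sat M w \<phi>" "sat M v \<psi> \<longleftrightarrow> sat M w \<psi>"
    by (rule Conj.IH; use Conj.prems in auto)+
  then show ?case by simp
qed

lemma finite_fv_term: "finite (fv_term t)"
  by (induction t) auto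

lemma finite_fv: "finite (fv \<phi>)"
  by (induction \<phi>) (auto simp: finite_fv_term)

lemma extension_term_val:
  assumes "is_extension N M" "range v \<subseteq> univ M" "term_in_PV t"
  shows "term_val M v t \<in> univ M \<and> term_val N v t = term_val M v t"
  using assms(3)
proof (induction t)
  case (Var x)
  then show ?case using assms(2) by auto
next
  case (Fun e ts)
  then have IH: "\<And>t. t \<in> set ts \<Longrightarrow> term_val M v t \<in> univ M \<and> term_val N v t = term_val M v t"
    by (simp add: list_all_iff)
  then have eq: "map (term_val N v) ts = map (term_val M v) ts" by auto
  have "pv_symbol (length ts) e \<and> length (map (term_val M v) ts) = length ts \<and>
      set (map (term_val M v) ts) \<subseteq> univ M"
    using Fun.prems IH by auto
  then have "interp M e (map (term_val M v) ts) \<in> univ M"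
    "interp N e (map (term_val M v) ts) = interp M e (map (term_val M v) ts)"
    using assms(1) unfolding is_extension_def is_structure_def by blast+
  then show ?case by (simp only: term_val.simps eq simp_thms)
qed

lemma extension_sat_quantifier_free:
  assumes "is_extension N M" "range v \<subseteq> univ M"
  shows "quantifier_free \<phi> \<Longrightarrow> form_in_PV \<phi> \<Longrightarrow> sat N v \<phi> \<longleftrightarrow> sat M v \<phi>"
  by (induction \<phi>) (auto simp: extension_term_val[OF assms])

text \<open>Quantifiers over the larger structure are instantiated by elements of the smaller one,
  and at the quantifier free kernel the two structures agree.\<close>

lemma extension_sat_universal:
  assumes "is_extension N M"
  shows "universal \<phi> \<Longrightarrow> form_in_PV \<phi> \<Longrightarrow> range v \<subseteq> univ M \<Longrightarrow> sat N v \<phi> \<Longrightarrow> sat M v \<phi>"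
proof (induction arbitrary: v rule: universal.induct)
  case (1 \<phi>)
  then show ?case using extension_sat_quantifier_free[OF assms] by blast
next
  case (2 \<phi> x)
  show ?case
    unfolding sat.simps
  proof
    fix a assume a: "a \<in> univ M"
    then have "a \<in> univ N" using assms by (auto simp: is_extension_def)
    then show "sat M (v(x := a)) \<phi>"
      using 2 a by (intro "2.IH") (auto simp: fun_upd_def image_subset_iff)
  qed
qed

text \<open>Universal sentences pass down to substructures, so a single extension satisfying true
  arithmetic certifies the common substructure.\<close>

lemma submodel_PV_N:
  assumes "is_extension N M" "is_model N AR_N"
  shows "is_model M PV_N"
  unfolding is_model_def
proof (intro conjI ballI)
  show "is_structure M" using assms(1) by (simp add: is_extension_def)
  fix \<phi> assume "\<phi> \<in> PV_N"
  then have \<phi>: "form_in_PV \<phi>" "universal \<phi>" "\<phi> \<in> AR_N"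
    by (auto simp: PV_N_def AR_N_def sentence_def)
  show "true_in M \<phi>"
    unfolding true_in_def
  proof (intro allI impI)
    fix v :: "nat \<Rightarrow> _" assume v: "range v \<subseteq> univ M"
    then have "range v \<subseteq> univ N" using assms(1) by (auto simp: is_extension_def)
    then have "sat N v \<phi>" using assms(2) \<phi>(3) by (simp add: is_model_def true_in_def)
    with extension_sat_universal[OF assms(1) \<phi>(2,1) v] show "sat M v \<phi>" by blast
  qed
qed

section \<open>A countable Skolem closed family of functions\<close>

instance pv_alg :: countable by countable_datatype
instance pv_term :: countable by countable_datatype
instance pv_form :: countable by countable_datatype

text \<open>Names for the functions of the family. A countable datatype of names makes the family
  countable, so that its members can be coded by natural numbers.\<close>

datatype skolem = Arg | App pv_alg "skolem list" | Witness nat pv_form "skolem list"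

instance skolem :: countable by countable_datatype

text \<open>\<open>Witness\<close> names the least counterexample to \<open>\<phi>\<close> in the
  variable \<open>x\<close>, because the primitive quantifier is universal. The entries of
  \<open>ts\<close> value the variables by index, and variables past the end get 0.\<close>

primrec skolem_val :: "nat \<Rightarrow> skolem \<Rightarrow> nat" where
  "skolem_val n Arg = n"
| "skolem_val n (App e ts) = pv_eval e (map (skolem_val n) ts)"
| "skolem_val n (Witness x \<phi> ts) =
    (let as = map (skolem_val n) ts in
     LEAST a. \<not> sat std_model ((\<lambda>i. if i < length as then as ! i else 0)(x := a)) \<phi>)"

definition skolem_funs :: "(nat \<Rightarrow> nat) set" where
  "skolem_funs = range (\<lambda>t n. skolem_val n t)"

lemma countable_skolem_funs: "countable skolem_funs"
  by (simp add: skolem_funs_def)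

lemma skolem_funs_list:
  assumes "set fs \<subseteq> skolem_funs"
  obtains ts where "fs = map (\<lambda>t n. skolem_val n t) ts"
proof -
  have "fs \<in> lists (range (\<lambda>t n. skolem_val n t))" using assms by (auto simp: skolem_funs_def)
  then show ?thesis using that by (auto simp: lists_image)
qed

lemma skolem_funs_App:
  assumes "set fs \<subseteq> skolem_funs"
  shows "(\<lambda>n. pv_eval e (map (\<lambda>f. f n) fs)) \<in> skolem_funs"
proof -
  obtain ts where fs: "fs = map (\<lambda>t n. skolem_val n t) ts"
    using skolem_funs_list[OF assms] .
  show ?thesis
    unfolding skolem_funs_def by (rule range_eqI[of _ _ "App e ts"]) (simp add: fs comp_def)
qed

text \<open>A formula has finitely many free variables, so an initial segment of the valuation
  \<open>g\<close> suffices as the parameter list of a \<open>Witness\<close> name.\<close>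

lemma skolem_funs_Witness:
  assumes "\<And>i. g i \<in> skolem_funs"
  obtains f where "f \<in> skolem_funs" "\<And>n a. \<not> sat std_model ((\<lambda>i. g i n)(x := a)) \<phi> \<Longrightarrow>
    \<not> sat std_model ((\<lambda>i. g i n)(x := f n)) \<phi>"
proof -
  obtain k where k: "\<And>i. i \<in> fv \<phi> \<Longrightarrow> i < k"
    using finite_fv[of \<phi>] unfolding finite_nat_set_iff_bounded by blast
  obtain ts where ts: "map g [0..<k] = map (\<lambda>t n. skolem_val n t) ts"
    using skolem_funs_list[of "map g [0..<k]"] assms by auto
  have len: "length ts = k" using arg_cong[OF ts, of length] by simp
  have val: "skolem_val n (ts ! i) = g i n" if "i < k" for i n
  proof -
    have "map g [0..<k] ! i = map (\<lambda>t n. skolem_val n t) ts ! i" by (simp only: ts)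
    with that len have "g i = (\<lambda>n. skolem_val n (ts ! i))" by simp
    then show ?thesis by simp
  qed
  define f where "f = (\<lambda>n. skolem_val n (Witness x \<phi> ts))"
  have "sat std_model ((\<lambda>i. if i < length (map (skolem_val n) ts) then map (skolem_val n) ts ! i else 0)(x := a)) \<phi>
      \<longleftrightarrow> sat std_model ((\<lambda>i. g i n)(x := a)) \<phi>" for n a
    by (rule sat_cong) (use k val len in auto)
  then have f: "f n = (LEAST a. \<not> sat std_model ((\<lambda>i. g i n)(x := a)) \<phi>)" for n
    by (simp only: f_def skolem_val.simps Let_def)
  show ?thesis
  proof (rule that[of f])
    show "f \<in> skolem_funs" unfolding f_def skolem_funs_def by (rule rangeI)
    show "\<not> sat std_model ((\<lambda>i. g i n)(x := f n)) \<phi>"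
      if "\<not> sat std_model ((\<lambda>i. g i n)(x := a)) \<phi>" for n a
      unfolding f using that by (rule LeastI)
  qed
qed

lemma polytime_funs_subset_skolem_funs: "polytime_funs \<subseteq> skolem_funs"
proof
  fix f assume "f \<in> polytime_funs"
  then obtain e where "f = (\<lambda>n. pv_eval e [n])" by (rule polytime_funs_pv_eval)
  then show "f \<in> skolem_funs"
    unfolding skolem_funs_def by (intro range_eqI[of _ _ "App e [Arg]"]) simp
qed

section \<open>Skolem ultrapowers with universe in the natural numbers\<close>

text \<open>Functions are coded by numbers so that all models live on one type and inclusion of
  universes can hold literally.\<close>

definition enc :: "(nat \<Rightarrow> nat) \<Rightarrow> nat" where "enc = to_nat_on skolem_funs"
definition dec :: "nat \<Rightarrow> nat \<Rightarrow> nat" where "dec = from_nat_into skolem_funs"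

lemma dec_enc: "f \<in> skolem_funs \<Longrightarrow> dec (enc f) = f"
  by (simp add: enc_def dec_def countable_skolem_funs)

definition equiv_mod :: "nat filter \<Rightarrow> (nat \<Rightarrow> nat) \<Rightarrow> (nat \<Rightarrow> nat) \<Rightarrow> bool" where
  "equiv_mod U f g \<longleftrightarrow> eventually (\<lambda>n. f n = g n) U"

text \<open>Preferring polynomial time representatives makes the code of the class of a polynomial
  time function the same in all the models.\<close>

definition rep :: "nat filter \<Rightarrow> (nat \<Rightarrow> nat) \<Rightarrow> nat \<Rightarrow> nat" where
  "rep U f = (if \<exists>g\<in>polytime_funs. equiv_mod U f g then SOME g. g \<in> polytime_funs \<and> equiv_mod U f g
     else SOME g. g \<in> skolem_funs \<and> equiv_mod U f g)"

definition ultra_interp :: "nat filter \<Rightarrow> pv_alg \<Rightarrow> nat list \<Rightarrow> nat" where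
  "ultra_interp U e xs = enc (rep U (\<lambda>n. pv_eval e (map (\<lambda>x. dec x n) xs)))"

definition ultra_model :: "nat filter \<Rightarrow> nat pv_struct" where
  "ultra_model U = \<lparr>univ = (\<lambda>f. enc (rep U f)) ` skolem_funs, interp = ultra_interp U\<rparr>"

definition polytime_model :: "nat filter \<Rightarrow> nat pv_struct" where
  "polytime_model U = \<lparr>univ = (\<lambda>f. enc (rep U f)) ` polytime_funs, interp = ultra_interp U\<rparr>"

lemma equiv_mod_refl: "equiv_mod U f f"
  by (simp add: equiv_mod_def)

lemma equiv_mod_sym: "equiv_mod U f g \<Longrightarrow> equiv_mod U g f"
  by (simp add: equiv_mod_def eq_commute)

lemma equiv_mod_trans: "equiv_mod U f g \<Longrightarrow> equiv_mod U g h \<Longrightarrow> equiv_mod U f h"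
  unfolding equiv_mod_def by (erule eventually_elim2) auto

text \<open>\<open>rep\<close> refers to \<open>f\<close> only through its class
  \<open>equiv_mod U f\<close>.\<close>

lemma rep_cong: "equiv_mod U f g \<Longrightarrow> rep U f = rep U g"
proof -
  assume "equiv_mod U f g"
  then have "equiv_mod U f = equiv_mod U g"
    by (intro ext) (metis equiv_mod_sym equiv_mod_trans)
  then show ?thesis by (simp add: rep_def)
qed

lemma rep_polytime: "f \<in> polytime_funs \<Longrightarrow> rep U f \<in> polytime_funs \<and> equiv_mod U f (rep U f)"
  unfolding rep_def using someI_ex[of "\<lambda>g. g \<in> polytime_funs \<and> equiv_mod U f g"] equiv_mod_refl
  by auto

lemma rep_skolem:
  assumes "f \<in> skolem_funs"
  shows "rep U f \<in> skolem_funs \<and> equiv_mod U f (rep U f)"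
proof (cases "\<exists>g\<in>polytime_funs. equiv_mod U f g")
  case True
  then show ?thesis
    using someI_ex[of "\<lambda>g. g \<in> polytime_funs \<and> equiv_mod U f g"] polytime_funs_subset_skolem_funs
    unfolding rep_def by auto
next
  case False
  then show ?thesis
    using someI[of "\<lambda>g. g \<in> skolem_funs \<and> equiv_mod U f g" f] assms equiv_mod_refl
    unfolding rep_def by auto
qed

lemma dec_rep: "f \<in> skolem_funs \<Longrightarrow> dec (enc (rep U f)) = rep U f"
  by (simp add: dec_enc rep_skolem)

lemma ultra_model_dec:
  assumes "x \<in> univ (ultra_model U)"
  shows "dec x \<in> skolem_funs" "enc (rep U (dec x)) = x"
proof -
  obtain f where f: "f \<in> skolem_funs" "x = enc (rep U f)"
    using assms by (auto simp: ultra_model_def)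
  then show "dec x \<in> skolem_funs" by (simp add: dec_rep rep_skolem)
  from f show "enc (rep U (dec x)) = x"
    using rep_cong[of U f "rep U f"] rep_skolem[of f U] by (simp add: dec_rep)
qed

text \<open>The universe contains one code per class, so equality in the structure is equivalence
  modulo \<open>U\<close> and no quotient is formed.\<close>

lemma ultra_model_eq_iff:
  assumes "x \<in> univ (ultra_model U)" "y \<in> univ (ultra_model U)"
  shows "x = y \<longleftrightarrow> equiv_mod U (dec x) (dec y)"
  using ultra_model_dec[OF assms(1)] ultra_model_dec[OF assms(2)] rep_cong equiv_mod_refl by metis

lemma polytime_model_dec: "x \<in> univ (polytime_model U) \<Longrightarrow> dec x \<in> polytime_funs"
  using rep_polytime polytime_funs_subset_skolem_funs by (auto simp: polytime_model_def dec_rep)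

lemma ultra_interp_in:
  assumes "set xs \<subseteq> univ (ultra_model U)"
  shows "ultra_interp U e xs \<in> univ (ultra_model U)"
    "equiv_mod U (dec (ultra_interp U e xs)) (\<lambda>n. pv_eval e (map (\<lambda>x. dec x n) xs))"
proof -
  have "(\<lambda>n. pv_eval e (map (\<lambda>f. f n) (map dec xs))) \<in> skolem_funs"
    by (rule skolem_funs_App) (use assms ultra_model_dec in auto)
  then have *: "(\<lambda>n. pv_eval e (map (\<lambda>x. dec x n) xs)) \<in> skolem_funs" by (simp add: comp_def)
  from * show "ultra_interp U e xs \<in> univ (ultra_model U)"
    by (simp add: ultra_model_def ultra_interp_def)
  from * show "equiv_mod U (dec (ultra_interp U e xs)) (\<lambda>n. pv_eval e (map (\<lambda>x. dec x n) xs))"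
    by (simp add: ultra_interp_def dec_rep rep_skolem equiv_mod_sym)
qed

lemma is_structure_ultra_model: "is_structure (ultra_model U)"
proof -
  have "interp (ultra_model U) = ultra_interp U" by (simp add: ultra_model_def)
  moreover have "univ (ultra_model U) \<noteq> {}"
    by (simp add: ultra_model_def skolem_funs_def)
  ultimately show ?thesis using ultra_interp_in by (simp add: is_structure_def)
qed

text \<open>The case of terms in Los's theorem: the finitely many argument terms are evaluated
  correctly on a common set of the filter, and the symbol is evaluated pointwise.\<close>

lemma term_val_ultra_model:
  assumes "range v \<subseteq> univ (ultra_model U)"
  shows "term_val (ultra_model U) v t \<in> univ (ultra_model U) \<and>
    equiv_mod U (dec (term_val (ultra_model U) v t)) (\<lambda>n. term_val std_model (\<lambda>i. dec (v i) n) t)"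
proof (induction t)
  case (Var x)
  then show ?case using assms by (auto simp: equiv_mod_refl)
next
  case (Fun e ts)
  let ?xs = "map (term_val (ultra_model U) v) ts"
  have eq: "term_val (ultra_model U) v (Fun e ts) = ultra_interp U e ?xs"
    by (simp add: ultra_model_def)
  have xs: "set ?xs \<subseteq> univ (ultra_model U)" using Fun by auto
  have "eventually (\<lambda>n. \<forall>t\<in>set ts. dec (term_val (ultra_model U) v t) n = term_val std_model (\<lambda>i. dec (v i) n) t) U"
    by (rule eventually_ball_finite) (use Fun in \<open>auto simp: equiv_mod_def\<close>)
  then have "equiv_mod U (\<lambda>n. pv_eval e (map (\<lambda>x. dec x n) ?xs)) (\<lambda>n. term_val std_model (\<lambda>i. dec (v i) n) (Fun e ts))"
    unfolding equiv_mod_def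
    by (rule eventually_mono) (auto simp: std_model_def comp_def intro!: arg_cong[where f = "pv_eval e"])
  with ultra_interp_in[OF xs, of e] show ?case
    unfolding eq using equiv_mod_trans by blast
qed

text \<open>Los's theorem for the restricted ultrapower. Connectives use the properties of
  ultrafilters; for the quantifier the family has to contain a function choosing counterexamples,
  which Skolem closure provides.\<close>

lemma Los:
  assumes U: "ultra U"
  shows "range v \<subseteq> univ (ultra_model U) \<Longrightarrow>
    sat (ultra_model U) v \<phi> \<longleftrightarrow> eventually (\<lambda>n. sat std_model (\<lambda>i. dec (v i) n) \<phi>) U"
proof (induction \<phi> arbitrary: v)
  case (Eq t u)
  note t = term_val_ultra_model[OF Eq, of t] and u = term_val_ultra_model[OF Eq, of u]
  have "sat (ultra_model U) v (Eq t u) \<longleftrightarrow>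
      equiv_mod U (dec (term_val (ultra_model U) v t)) (dec (term_val (ultra_model U) v u))"
    using t u ultra_model_eq_iff by simp
  also have "\<dots> \<longleftrightarrow> equiv_mod U (\<lambda>n. term_val std_model (\<lambda>i. dec (v i) n) t) (\<lambda>n. term_val std_model (\<lambda>i. dec (v i) n) u)"
    using t u equiv_mod_sym equiv_mod_trans by meson
  finally show ?case by (simp add: equiv_mod_def)
next
  case (Neg \<phi>)
  then show ?case by (simp add: ultra_eventually_not_iff[OF U])
next
  case (Conj \<phi> \<psi>)
  then show ?case by (simp add: eventually_conj_iff)
next
  case (All x \<phi>)
  have IH: "sat (ultra_model U) (v(x := a)) \<phi> \<longleftrightarrow>
      eventually (\<lambda>n. sat std_model ((\<lambda>i. dec (v i) n)(x := dec a n)) \<phi>) U"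
    if "a \<in> univ (ultra_model U)" for a
  proof -
    have "range (v(x := a)) \<subseteq> univ (ultra_model U)" using All.prems that by auto
    moreover have "(\<lambda>i. dec ((v(x := a)) i) n) = (\<lambda>i. dec (v i) n)(x := dec a n)" for n by auto
    ultimately show ?thesis using All.IH[of "v(x := a)"] by (simp only: )
  qed
  have univ_std: "univ std_model = UNIV" by (simp add: std_model_def)
  show ?case
  proof
    assume "eventually (\<lambda>n. sat std_model (\<lambda>i. dec (v i) n) (All x \<phi>)) U"
    then show "sat (ultra_model U) v (All x \<phi>)"
      using IH by (auto simp: univ_std elim: eventually_mono)
  next
    assume sat: "sat (ultra_model U) v (All x \<phi>)"
    have "dec (v i) \<in> skolem_funs" for i using All.prems ultra_model_dec by blast
    \<comment> \<open>\<open>f\<close> picks a counterexample at every \<open>n\<close> where there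
      is one. Since \<open>\<phi>\<close> holds of the class of \<open>f\<close>, it holds at
      \<open>f n\<close> for eventually all \<open>n\<close>, and there no counterexample
      exists.\<close>
    then obtain f where f: "f \<in> skolem_funs" "\<And>n a. \<not> sat std_model ((\<lambda>i. dec (v i) n)(x := a)) \<phi> \<Longrightarrow>
        \<not> sat std_model ((\<lambda>i. dec (v i) n)(x := f n)) \<phi>"
      using skolem_funs_Witness[of "\<lambda>i. dec (v i)" x \<phi>] by metis
    let ?a = "enc (rep U f)"
    have "?a \<in> univ (ultra_model U)" using f(1) by (simp add: ultra_model_def)
    then have "eventually (\<lambda>n. sat std_model ((\<lambda>i. dec (v i) n)(x := dec ?a n)) \<phi>) U"
      using IH sat by simp
    moreover have "eventually (\<lambda>n. f n = dec ?a n) U"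
      using rep_skolem[OF f(1), of U] by (simp add: dec_rep[OF f(1)] equiv_mod_def)
    ultimately show "eventually (\<lambda>n. sat std_model (\<lambda>i. dec (v i) n) (All x \<phi>)) U"
    proof eventually_elim
      case (elim n)
      then show ?case using f(2)[of n] by (auto simp: univ_std)
    qed
  qed
qed

lemma is_model_ultra_model: "ultra U \<Longrightarrow> is_model (ultra_model U) AR_N"
  by (auto simp: is_model_def is_structure_ultra_model true_in_def AR_N_def Los std_model_def)

section \<open>The common substructure of the ultrapowers\<close>

definition decides :: "nat filter \<Rightarrow> nat set \<Rightarrow> bool" where
  "decides F A \<longleftrightarrow> eventually (\<lambda>n. n \<in> A) F \<or> eventually (\<lambda>n. n \<notin> A) F"

text \<open>The set where \<open>f\<close> and \<open>g\<close> agree is polynomial time, hence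
  decided by \<open>F\<close>, and a finer ultrafilter cannot reverse the decision.\<close>

lemma equiv_mod_polytime:
  assumes F: "\<And>A. A \<in> polytime_sets \<Longrightarrow> decides F A" and "ultra U" "U \<le> F"
    and "f \<in> polytime_funs" "g \<in> polytime_funs"
  shows "equiv_mod U f g \<longleftrightarrow> equiv_mod F f g"
proof
  assume "equiv_mod F f g"
  with assms(3) show "equiv_mod U f g" unfolding equiv_mod_def by (rule filter_leD)
next
  assume U: "equiv_mod U f g"
  from F[OF polytime_sets_eq[OF assms(4,5)]] show "equiv_mod F f g"
    unfolding decides_def
  proof
    assume "eventually (\<lambda>n. n \<notin> {n. f n = g n}) F"
    then have "eventually (\<lambda>n. f n \<noteq> g n) U" using filter_leD[OF assms(3)] by simp
    with U show ?thesis by (simp add: equiv_mod_def ultra_eventually_not_iff[OF assms(2)])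
  qed (simp add: equiv_mod_def)
qed

lemma is_extension_ultra_model:
  assumes F: "\<And>A. A \<in> polytime_sets \<Longrightarrow> decides F A" and U: "ultra U" "U \<le> F"
  shows "is_extension (ultra_model U) (polytime_model F)"
proof -
  \<comment> \<open>\<open>U\<close> and \<open>F\<close> induce the same equivalence on polynomial
    time functions, so the choice operator is applied to the same predicate and selects the same
    representative.\<close>
  have rep_eq: "rep U f = rep F f" if "f \<in> polytime_funs" for f
  proof -
    have "(g \<in> polytime_funs \<and> equiv_mod U f g) = (g \<in> polytime_funs \<and> equiv_mod F f g)" for g
      using equiv_mod_polytime[OF F U that] by blast
    moreover have "\<exists>g\<in>polytime_funs. equiv_mod V f g" for V using that equiv_mod_refl by blast
    ultimately show ?thesis by (simp add: rep_def)
  qed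
  have in_poly: "(\<lambda>n. pv_eval e (map (\<lambda>x. dec x n) xs)) \<in> polytime_funs"
    if "pv_symbol (length xs) e" "set xs \<subseteq> univ (polytime_model F)" for e xs
  proof -
    have "(\<lambda>n. pv_eval e (map (\<lambda>f. f n) (map dec xs))) \<in> polytime_funs"
      by (rule polytime_funs_Comp) (use that polytime_model_dec in auto)
    then show ?thesis by (simp add: comp_def)
  qed
  show ?thesis
    unfolding is_extension_def
  proof (intro conjI allI impI)
    show "is_structure (polytime_model F)"
      unfolding is_structure_def
    proof (intro conjI allI impI)
      show "univ (polytime_model F) \<noteq> {}" using polytime_funs_id by (auto simp: polytime_model_def)
      fix n e xs assume "pv_symbol n e \<and> length xs = n \<and> set xs \<subseteq> univ (polytime_model F)"
      then show "interp (polytime_model F) e xs \<in> univ (polytime_model F)"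
        using in_poly by (auto simp: polytime_model_def ultra_interp_def)
    qed
    show "univ (polytime_model F) \<subseteq> univ (ultra_model U)"
      using polytime_funs_subset_skolem_funs
      by (auto simp: polytime_model_def ultra_model_def simp flip: rep_eq)
    fix n e xs assume "pv_symbol n e \<and> length xs = n \<and> set xs \<subseteq> univ (polytime_model F)"
    then show "interp (ultra_model U) e xs = interp (polytime_model F) e xs"
      using rep_eq[OF in_poly] by (simp add: polytime_model_def ultra_model_def ultra_interp_def)
  qed (rule is_structure_ultra_model)
qed

section \<open>Pseudorandom sequences\<close>

text \<open>The indicator of \<open>A\<close> is half the sum of the
  \<open>\<plusminus>1\<close>-valued function of \<open>A\<close> and the constant 1. Vanishing
  correlation of \<open>s\<close> with both gives \<open>?S \<inter> A\<close> and
  \<open>A - ?S\<close> equal density, and these two sets split \<open>A\<close>.\<close>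

lemma pseudorandom_half:
  assumes s: "pseudorandom s" and A: "A \<in> polytime_sets"
    and d: "charge d" "\<And>D E. (\<lambda>n. (real (card (D \<inter> {..<n})) - real (card (E \<inter> {..<n}))) / real n) \<longlonglongrightarrow> 0 \<Longrightarrow> d D = d E"
  shows "d ({n. s n = 1} \<inter> A) = 1 / 2 * d A"
proof -
  let ?S = "{n. s n = 1}"
  have s_val: "s i = 1 \<or> s i = -1" for i
    using s by (auto simp: pseudorandom_def)
  have avg: "(\<lambda>n. 1 / real n * (\<Sum>i<n. (if i \<in> B then 1 else -1) * s i)) \<longlonglongrightarrow> 0"
    if "B \<in> polytime_sets" for B
    using s polytime_sign_set[OF that] by (simp add: pseudorandom_def)
  \<comment> \<open>The constant 1 is written as the sign function of \<open>UNIV\<close> so that it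
    falls under \<open>avg\<close>.\<close>
  have "(real (card (?S \<inter> A \<inter> {..<n})) - real (card ((A - ?S) \<inter> {..<n}))) / real n =
      1 / 2 * (1 / real n * (\<Sum>i<n. (if i \<in> A then 1 else -1) * s i)
        + 1 / real n * (\<Sum>i<n. (if i \<in> UNIV then 1 else -1) * s i))" for n
  proof -
    have card: "real (card (D \<inter> {..<n})) = (\<Sum>i<n. if i \<in> D then 1 else 0)" for D
      by (simp add: sum.If_cases Int_commute)
    have "real (card (?S \<inter> A \<inter> {..<n})) - real (card ((A - ?S) \<inter> {..<n}))
        = (\<Sum>i<n. (if i \<in> ?S \<inter> A then 1 else 0) - (if i \<in> A - ?S then 1 else 0))"
      unfolding card by (simp add: sum_subtractf)
    also have "\<dots> = (\<Sum>i<n. 1 / 2 * ((if i \<in> A then 1 else -1) * s i + s i))"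
    proof (rule sum.cong)
      show "(if i \<in> ?S \<inter> A then 1 else 0) - (if i \<in> A - ?S then 1 else 0)
          = 1 / 2 * ((if i \<in> A then 1 else -1) * s i + s i)" for i
        using s_val[of i] by auto
    qed simp
    also have "\<dots> = 1 / 2 * ((\<Sum>i<n. (if i \<in> A then 1 else -1) * s i) + (\<Sum>i<n. s i))"
      by (simp only: sum.distrib flip: sum_distrib_left)
    finally show ?thesis by (simp add: add_divide_distrib)
  qed
  moreover have "(\<lambda>n. 1 / 2 * (1 / real n * (\<Sum>i<n. (if i \<in> A then 1 else -1) * s i)
        + 1 / real n * (\<Sum>i<n. (if i \<in> UNIV then 1 else -1) * s i))) \<longlonglongrightarrow> 1 / 2 * (0 + 0)"
    by (intro tendsto_intros avg A polytime_sets_UNIV)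
  ultimately have "d (?S \<inter> A) = d (A - ?S)"
    by (intro d(2)) (simp only: add_0_left mult_zero_right)
  then show ?thesis using charge_split[OF d(1), of A ?S] by (simp add: Int_commute)
qed

text \<open>For the measurability of definable events. Parameters from the common substructure are
  decoded to the same functions for all \<open>U\<close>, so by Los's theorem one set
  \<open>D\<close> of numbers serves every \<open>U\<close>.\<close>

lemma sat_ultra_model_polytime:
  assumes F: "\<And>A. A \<in> polytime_sets \<Longrightarrow> decides F A" and v: "v ` fv \<phi> \<subseteq> univ (polytime_model F)"
  obtains D where "{U \<in> stone F UNIV. sat (ultra_model U) v \<phi>} = stone F D"
proof -
  let ?\<iota> = "enc (rep F (\<lambda>n. n))"
  have \<iota>: "?\<iota> \<in> univ (polytime_model F)" using polytime_funs_id by (simp add: polytime_model_def)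
  \<comment> \<open>Only the free variables are known to take values in the common substructure; the
    others are reset to an element of it, because Los's theorem needs a full valuation in the
    universe.\<close>
  define w where "w i = (if i \<in> fv \<phi> then v i else ?\<iota>)" for i
  have "sat (ultra_model U) v \<phi> \<longleftrightarrow> eventually (\<lambda>n. n \<in> {n. sat std_model (\<lambda>i. dec (w i) n) \<phi>}) U"
    if U: "ultra U" "U \<le> F" for U
  proof -
    have "univ (polytime_model F) \<subseteq> univ (ultra_model U)"
      using is_extension_ultra_model[OF F U] by (simp add: is_extension_def)
    then have "range w \<subseteq> univ (ultra_model U)" using v \<iota> by (auto simp: w_def)
    moreover have "sat (ultra_model U) v \<phi> \<longleftrightarrow> sat (ultra_model U) w \<phi>"
      by (rule sat_cong) (simp add: w_def)
    ultimately show ?thesis using Los[OF U(1)] by simp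
  qed
  then show ?thesis
    by (intro that[of "{n. sat std_model (\<lambda>i. dec (w i) n) \<phi>}"]) (auto simp: stone_def)
qed

text \<open>The representative of the identity agrees with the identity eventually in
  \<open>F\<close>, hence in every finer ultrafilter, so this is Los's theorem at the identity
  function.\<close>

lemma sat1_ultra_model_generic:
  assumes F: "\<And>A. A \<in> polytime_sets \<Longrightarrow> decides F A" and U: "ultra U" "U \<le> F"
  shows "sat1 (ultra_model U) \<sigma> (enc (rep F (\<lambda>n. n))) \<longleftrightarrow> eventually (\<lambda>n. sat1 std_model \<sigma> n) U"
proof -
  let ?r = "rep F (\<lambda>n. n)"
  have r: "?r \<in> skolem_funs" "equiv_mod F (\<lambda>n. n) ?r"
    using rep_polytime[OF polytime_funs_id] polytime_funs_subset_skolem_funs by auto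
  have "enc ?r \<in> univ (polytime_model F)" using polytime_funs_id by (simp add: polytime_model_def)
  then have "enc ?r \<in> univ (ultra_model U)"
    using is_extension_ultra_model[OF F U] by (auto simp: is_extension_def)
  then have "sat1 (ultra_model U) \<sigma> (enc ?r) \<longleftrightarrow> eventually (\<lambda>n. sat1 std_model \<sigma> (?r n)) U"
    unfolding sat1_def using Los[OF U(1), of "\<lambda>_. enc ?r" \<sigma>] by (simp add: dec_enc[OF r(1)])
  also have "\<dots> \<longleftrightarrow> eventually (\<lambda>n. sat1 std_model \<sigma> n) U"
  proof (rule eventually_cong)
    show "eventually (\<lambda>n. ?r n = n) U"
      using filter_leD[OF U(2)] r(2) by (simp add: equiv_mod_def eq_commute)
  qed simp
  finally show ?thesis .
qed

section \<open>The random model of true arithmetic\<close>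

theorem theorem2:
  shows "\<exists>(M0 :: nat pv_struct) \<iota> (\<M> :: nat pv_struct set) (\<nu> :: nat pv_struct measure).
    is_model M0 PV_N \<and> \<iota> \<in> univ M0 \<and>
    (\<forall>M \<in> \<M>. is_model M AR_N) \<and>
    prob_space \<nu> \<and> space \<nu> = \<M> \<and>
    (\<forall>M \<in> \<M>. is_extension M M0) \<and>
    (\<forall>\<phi> v. form_in_PV \<phi> \<and> v ` fv \<phi> \<subseteq> univ M0 \<longrightarrow> {M \<in> \<M>. sat M v \<phi>} \<in> sets \<nu>) \<and>
    (\<forall>\<sigma> x. form_in_PV \<sigma> \<and> fv \<sigma> \<subseteq> {x} \<and> pseudorandom (defined_seq \<sigma>) \<longrightarrow>
      measure \<nu> {M \<in> \<M>. sat1 M \<sigma> \<iota>} = 1 / 2)"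
proof -
  obtain d :: "nat set \<Rightarrow> real" where d: "charge d"
    "\<And>D E. (\<lambda>n. (real (card (D \<inter> {..<n})) - real (card (E \<inter> {..<n}))) / real n) \<longlonglongrightarrow> 0 \<Longrightarrow> d D = d E"
    using density_charge by metis
  obtain U0 m where U0: "ultra U0" and m: "charge m"
    and m1: "\<And>A. A \<in> polytime_sets \<Longrightarrow> eventually (\<lambda>x. x \<in> A) U0 \<Longrightarrow> m A = 1"
    and m_half: "\<And>S c. (\<And>A. A \<in> polytime_sets \<Longrightarrow> d (S \<inter> A) = c * d A) \<Longrightarrow> m S = c"
    using charge_concentrate[OF d(1) polytime_sets_UNIV polytime_sets_Int] by metis
  \<comment> \<open>The polynomial time members of \<open>U0\<close> generate a filter that decides
    every polynomial time set and whose members all have \<open>m\<close>-measure 1.\<close>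
  define Q where "Q = {A \<in> polytime_sets. eventually (\<lambda>n. n \<in> A) U0}"
  define F where "F = (INF A\<in>Q. principal A)"
  have ev_F: "eventually P F \<longleftrightarrow> (\<exists>A\<in>Q. \<forall>n\<in>A. P n)" for P
  proof -
    have "eventually P F \<longleftrightarrow> (\<exists>A\<in>Q. eventually P (principal A))"
      unfolding F_def
    proof (rule eventually_INF_base)
      show "Q \<noteq> {}" using polytime_sets_UNIV by (auto simp: Q_def)
      show "\<exists>C\<in>Q. principal C \<le> inf (principal A) (principal B)" if "A \<in> Q" "B \<in> Q" for A B
        by (rule bexI[of _ "A \<inter> B"]) (use that polytime_sets_Int in \<open>auto simp: Q_def eventually_conj_iff\<close>)
    qed
    then show ?thesis by (simp add: eventually_principal)
  qed
  have dec: "decides F A" if "A \<in> polytime_sets" for A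
    using U0 that polytime_sets_Compl[OF that] unfolding decides_def ev_F Q_def ultra_def
    by (metis (mono_tags, lifting) ComplD ComplI eventually_mono mem_Collect_eq)
  have full: "m D = 1" if ev: "eventually (\<lambda>n. n \<in> D) F" for D
  proof -
    obtain A where "A \<in> Q" "A \<subseteq> D" using ev ev_F by auto
    then show ?thesis
      using m1[of A] charge_mono[OF m, of A D] charge_le_1[OF m, of D] by (simp add: Q_def)
  qed
  obtain \<mu> where \<mu>: "prob_space \<mu>" "space \<mu> = stone F UNIV"
    "\<And>D. stone F D \<in> sets \<mu>" "\<And>D. measure \<mu> (stone F D) = m D"
    using stone_measure_exists[OF m full] by metis
  define M0 where "M0 = polytime_model F"
  define \<iota> where "\<iota> = enc (rep F (\<lambda>n. n))"
  define \<M> where "\<M> = ultra_model ` stone F UNIV"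
  \<comment> \<open>The events definable with parameters in \<open>M0\<close> generate the
    \<sigma>-algebra; their preimages under \<open>ultra_model\<close> are basic sets, so
    \<open>\<mu>\<close> can be pushed forward.\<close>
  define \<G> where "\<G> = {{M \<in> \<M>. sat M v \<phi>} | v \<phi>. v ` fv \<phi> \<subseteq> univ M0}"
  define \<nu> where "\<nu> = distr \<mu> (sigma \<M> \<G>) ultra_model"
  have ext: "is_extension M M0" if "M \<in> \<M>" for M
    using that is_extension_ultra_model[OF dec] by (auto simp: \<M>_def M0_def stone_def)
  have AR: "is_model M AR_N" if "M \<in> \<M>" for M
    using that is_model_ultra_model by (auto simp: \<M>_def stone_def)
  have \<iota>: "\<iota> \<in> univ M0"
    using polytime_funs_id by (simp add: \<iota>_def M0_def polytime_model_def)
  have \<G>: "\<G> \<subseteq> Pow \<M>" by (auto simp: \<G>_def)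
  \<comment> \<open>A probability space has a point; the model there passes the universal sentences
    of true arithmetic down to \<open>M0\<close>.\<close>
  have "stone F UNIV \<noteq> {}" using prob_space.not_empty[OF \<mu>(1)] \<mu>(2) by simp
  then obtain M where "M \<in> \<M>" by (auto simp: \<M>_def)
  then have M0: "is_model M0 PV_N" using submodel_PV_N ext AR by blast
  have meas: "ultra_model \<in> measurable \<mu> (sigma \<M> \<G>)"
  proof (rule measurable_measure_of[OF \<G>])
    show "ultra_model \<in> space \<mu> \<rightarrow> \<M>" by (auto simp: \<mu>(2) \<M>_def)
    fix Y assume "Y \<in> \<G>"
    then obtain v \<phi> where Y: "Y = {M \<in> \<M>. sat M v \<phi>}" "v ` fv \<phi> \<subseteq> univ (polytime_model F)"
      by (auto simp: \<G>_def M0_def)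
    obtain D where "{U \<in> stone F UNIV. sat (ultra_model U) v \<phi>} = stone F D"
      using sat_ultra_model_polytime[OF dec Y(2)] .
    moreover have "ultra_model -` Y \<inter> space \<mu> = {U \<in> stone F UNIV. sat (ultra_model U) v \<phi>}"
      by (auto simp: Y(1) \<mu>(2) \<M>_def)
    ultimately show "ultra_model -` Y \<inter> space \<mu> \<in> sets \<mu>" using \<mu>(3) by simp
  qed
  have sets: "{M \<in> \<M>. sat M v \<phi>} \<in> sets \<nu>" if "v ` fv \<phi> \<subseteq> univ M0" for v \<phi>
    using that \<G> unfolding \<nu>_def sets_distr by (auto simp: \<G>_def intro!: sigma_sets.Basic)
  have half: "measure \<nu> {M \<in> \<M>. sat1 M \<sigma> \<iota>} = 1 / 2" if "pseudorandom (defined_seq \<sigma>)" for \<sigma>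
  proof -
    let ?S = "{n. sat1 std_model \<sigma> n}"
    have S: "?S = {n. defined_seq \<sigma> n = 1}" by (auto simp: defined_seq_def)
    \<comment> \<open>The constant valuation at \<open>\<iota>\<close> takes its values in
      \<open>M0\<close>, so the event is one of the generators.\<close>
    have "{M \<in> \<M>. sat1 M \<sigma> \<iota>} \<in> sets (sigma \<M> \<G>)"
      using sets[of "\<lambda>_. \<iota>" \<sigma>] \<iota> by (simp add: sat1_def \<nu>_def image_subset_iff)
    then have "measure \<nu> {M \<in> \<M>. sat1 M \<sigma> \<iota>} = measure \<mu> (ultra_model -` {M \<in> \<M>. sat1 M \<sigma> \<iota>} \<inter> space \<mu>)"
      unfolding \<nu>_def by (rule measure_distr[OF meas])
    also have "ultra_model -` {M \<in> \<M>. sat1 M \<sigma> \<iota>} \<inter> space \<mu> = stone F ?S"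
      using sat1_ultra_model_generic[OF dec] by (auto simp: \<mu>(2) \<M>_def stone_def \<iota>_def)
    \<comment> \<open>Relative density 1/2 on every polynomial time set carries over to the limit
      \<open>m\<close>.\<close>
    also have "measure \<mu> \<dots> = 1 / 2"
      unfolding \<mu>(4) S by (rule m_half, rule pseudorandom_half[OF that _ d])
    finally show ?thesis .
  qed
  have "prob_space \<nu>" unfolding \<nu>_def by (rule prob_space.prob_space_distr[OF \<mu>(1) meas])
  moreover have "space \<nu> = \<M>" using \<G> by (simp add: \<nu>_def)
  ultimately show ?thesis
    using M0 \<iota> AR ext sets half
    by (intro exI[of _ M0] exI[of _ \<iota>] exI[of _ \<M>] exI[of _ \<nu>]) simp
qed

end
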